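(* Let $F\subset\mathbb{R}$ be a compact set with Minkowski dimension $\dim_M F =D\in(0,1)$ (i.e. in particular with Lebesgue measure $\lambda(F)=0$) and let $\mathcal{L}=(l_j)_{j=1}^\infty$ be the fractal string associated with $F$. (a) (Two sided bounds.) The following assertions are equivalent: (i) $0<\underline{\mathcal{M}}^D(F)\le\overline{\mathcal{M}}^D(F)<\infty$; (ii) $0<\underline{\mathcal{S}}^D(F)\le\overline{\mathcal{S}}^D(F)<\infty$; (iii) $l_j\approx j^{-1/D}$ as $j\to\infty$. (b) (Criterion of Minkowski measurability.) The following assertions are equivalent: (i) $F$ is ($D$-dimensional) Minkowski measurable; (ii) $F$ is ($D$-dimensional) S-measurable, i.e., $\mathcal{S}^D(F)$ exists and $0<\mathcal{S}^D(F)<\infty$; (iii) $l_j\sim L j^{-1/D}$ as $j\to\infty$ for some $L>0$. Under these latter assertions, the Minkowski and S-content of $F$ are given by $$\mathcal{M}^D(F)=\mathcal{S}^D(F)=\frac{2^{1-D}}{\kappa_{1-D}}\,\frac{L^D}{1-D}.$$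
   Context: For a compact $F\subset\mathbb{R}$, the associated fractal string is the nonincreasing sequence $\mathcal{L}=(l_j)_{j=1}^\infty$ of the lengths (with multiplicity) of the bounded complementary intervals of $F$, i.e. of the bounded connected components of $\mathbb{R}\setminus F$. For $r>0$ let $F_r:=\{z\in\mathbb{R}: d_F(z)\le r\}$ with $d_F$ the distance function of $F$, $V_F(r):=\mathcal{H}^1(F_r)$, where $\mathcal{H}^t$ is $t$-dimensional Hausdorff measure ($\mathcal{H}^0$ is counting measure), and $\kappa_t:=\pi^{t/2}/\Gamma(1+\tfrac t2)$. For $0\le s<1$ define $$\underline{\mathcal{M}}^s(F):=\liminf_{r\to0}\frac{V_F(r)}{\kappa_{1-s}r^{1-s}},\qquad \overline{\mathcal{M}}^s(F):=\limsup_{r\to0}\frac{V_F(r)}{\kappa_{1-s}r^{1-s}},$$ $$\underline{\mathcal{S}}^s(F):=\liminf_{r\to0}\frac{\mathcal{H}^0(\partial F_r)}{(1-s)\kappa_{1-s}r^{-s}},\qquad \overline{\mathcal{S}}^s(F):=\limsup_{r\to0}\frac{\mathcal{H}^0(\partial F_r)}{(1-s)\kappa_{1-s}r^{-s}}.$$ The Minkowski content $\mathcal{M}^s(F)$ (respectively S-content $\mathcal{S}^s(F)$) is the common value of the lower and upper contents if these coincide; $F$ is $s$-dimensional Minkowski measurable (respectively S-measurable) if this content exists and is positive and finite. The Minkowski contents for $s=1$ are given by the same formulas (with $\kappa_0=1$). The Minkowski dimension satisfies $\dim_M F=D$ if $$\inf\{0\le t\le 1:\underline{\mathcal{M}}^t(F)=0\}=\inf\{0\le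 t\le1:\overline{\mathcal{M}}^t(F)=0\}=D .$$ For positive sequences, $a_j\sim b_j$ as $j\to\infty$ means $\lim_{j\to\infty}a_j/b_j=1$, and $a_j\approx b_j$ as $j\to\infty$ means that there are positive constants $c,C$ and an index $j_0$ such that $c\le a_j/b_j\le C$ for all $j\ge j_0$. *)

theory Defs
  imports "HOL-Analysis.Analysis" "HOL-Library.Landau_Symbols"
begin

text \<open>
  Hausdorff measure, normalised by the volume \<open>unit_ball_vol t = pi powr (t/2) / Gamma (t/2 + 1)\<close>
  of the unit ball, so that the measure of dimension 1 on the real line is Lebesgue measure.
  Since \<open>0 powr 0 = 0\<close>, the case \<open>t = 0\<close> is treated separately in the gauge: each nonempty set
  then has weight 1, which makes the measure of dimension 0 the counting measure.
\<close>

definition hausdorff_gauge :: "real \<Rightarrow> 'a::metric_space set \<Rightarrow> ennreal" where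
  "hausdorff_gauge t U =
     (if U = {} then 0 else if t = 0 then 1
      else ennreal (unit_ball_vol t * (diameter U / 2) powr t))"

definition hausdorff_premeasure :: "real \<Rightarrow> real \<Rightarrow> 'a::metric_space set \<Rightarrow> ennreal" where
  "hausdorff_premeasure t \<delta> A =
     (INF U \<in> {U :: nat \<Rightarrow> 'a set. A \<subseteq> (\<Union>i. U i) \<and> (\<forall>i. bounded (U i) \<and> diameter (U i) \<le> \<delta>)}.
        \<Sum>i. hausdorff_gauge t (U i))"

definition hausdorff_measure :: "real \<Rightarrow> 'a::metric_space set \<Rightarrow> ennreal" where
  "hausdorff_measure t A = (SUP \<delta> \<in> {0<..}. hausdorff_premeasure t \<delta> A)"

definition parallel_set :: "real set \<Rightarrow> real \<Rightarrow> real set" where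
  "parallel_set F r = {z. infdist z F \<le> r}"

definition lower_minkowski_content :: "real \<Rightarrow> real set \<Rightarrow> ennreal" where
  "lower_minkowski_content s F =
     Liminf (at_right 0) (\<lambda>r. hausdorff_measure 1 (parallel_set F r)
       / ennreal (unit_ball_vol (1 - s) * r powr (1 - s)))"

definition upper_minkowski_content :: "real \<Rightarrow> real set \<Rightarrow> ennreal" where
  "upper_minkowski_content s F =
     Limsup (at_right 0) (\<lambda>r. hausdorff_measure 1 (parallel_set F r)
       / ennreal (unit_ball_vol (1 - s) * r powr (1 - s)))"

text \<open>The S-contents are meaningful for \<open>s < 1\<close> only.\<close>

definition lower_S_content :: "real \<Rightarrow> real set \<Rightarrow> ennreal" where
  "lower_S_content s F =
     Liminf (at_right 0) (\<lambda>r. hausdorff_measure 0 (frontier (parallel_set F r))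
       / ennreal ((1 - s) * unit_ball_vol (1 - s) * r powr (- s)))"

definition upper_S_content :: "real \<Rightarrow> real set \<Rightarrow> ennreal" where
  "upper_S_content s F =
     Limsup (at_right 0) (\<lambda>r. hausdorff_measure 0 (frontier (parallel_set F r))
       / ennreal ((1 - s) * unit_ball_vol (1 - s) * r powr (- s)))"

definition has_minkowski_content :: "real \<Rightarrow> real set \<Rightarrow> ennreal \<Rightarrow> bool" where
  "has_minkowski_content s F c \<longleftrightarrow>
     lower_minkowski_content s F = c \<and> upper_minkowski_content s F = c"

definition has_S_content :: "real \<Rightarrow> real set \<Rightarrow> ennreal \<Rightarrow> bool" where
  "has_S_content s F c \<longleftrightarrow> lower_S_content s F = c \<and> upper_S_content s F = c"

definition minkowski_measurable :: "real \<Rightarrow> real set \<Rightarrow> bool" where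
  "minkowski_measurable s F \<longleftrightarrow> (\<exists>c. has_minkowski_content s F c \<and> 0 < c \<and> c < \<infinity>)"

definition S_measurable :: "real \<Rightarrow> real set \<Rightarrow> bool" where
  "S_measurable s F \<longleftrightarrow> (\<exists>c. has_S_content s F c \<and> 0 < c \<and> c < \<infinity>)"

text \<open>
  The infima are taken in \<open>ereal\<close>, where the infimum of the empty set is \<open>\<infinity>\<close>; on \<open>real\<close> it would be
  an unspecified number. The sets are empty when \<open>F\<close> has positive measure (and when \<open>F = {}\<close>, since
  then \<open>infdist z F = 0\<close> everywhere), so that no real \<open>D\<close> qualifies in these cases.
\<close>

definition has_minkowski_dim :: "real set \<Rightarrow> real \<Rightarrow> bool" where
  "has_minkowski_dim F D \<longleftrightarrow>
     (INF t \<in> {t. 0 \<le> t \<and> t \<le> 1 \<and> lower_minkowski_content t F = 0}. ereal t) = ereal D \<and>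
     (INF t \<in> {t. 0 \<le> t \<and> t \<le> 1 \<and> upper_minkowski_content t F = 0}. ereal t) = ereal D"

text \<open>
  The sequence is indexed by \<open>j \<ge> 1\<close> and the value \<open>l 0\<close> is irrelevant. The enumeration \<open>I\<close> of the
  bounded complementary intervals is bijective, so lengths are listed with multiplicity. Strings are
  infinite here; this is no restriction for compact sets of Minkowski dimension strictly between 0
  and 1, whose complement has infinitely many bounded components.
\<close>

definition fractal_string :: "real set \<Rightarrow> (nat \<Rightarrow> real) \<Rightarrow> bool" where
  "fractal_string F l \<longleftrightarrow>
     (\<exists>I. bij_betw I {1..} {U \<in> components (- F). bounded U} \<and>
          (\<forall>j\<ge>1. l j = measure lborel (I j))) \<and>
     (\<forall>i j. 1 \<le> i \<and> i \<le> j \<longrightarrow> l j \<le> l i)"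

definition asymp_comparable :: "(nat \<Rightarrow> real) \<Rightarrow> (nat \<Rightarrow> real) \<Rightarrow> bool" where
  "asymp_comparable a b \<longleftrightarrow>
     (\<exists>c>0. \<exists>C>0. \<exists>j0. \<forall>j\<ge>j0. c \<le> a j / b j \<and> a j / b j \<le> C)"

end

theory Submission
  imports Defs
begin

text \<open>
  Everything about \<open>F\<close> that matters here is carried by two functions of \<open>r > 0\<close>: the volume \<open>V r\<close> of
  the parallel set and the number \<open>s r\<close> of its boundary points. A bounded gap of length \<open>w\<close> meets
  the complement of the parallel set exactly when \<open>w > 2r\<close>, and then in an open interval of length
  \<open>w - 2r\<close>. Hence \<open>s r = 2 + 2 * card {j. l j > 2r}\<close>, and \<open>V r\<close> is the length of the convex hull of \<open>F\<close>
  plus \<open>2r\<close> minus the sum of all \<open>l j - 2r\<close> that are positive. It follows that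
  \<open>(R - r) * s R \<le> V R - V r \<le> (R - r) * s r\<close> for \<open>r < R\<close>: the function \<open>V\<close> is a primitive of the
  nonincreasing function \<open>s\<close>. Moreover \<open>V r\<close> tends to 0 with \<open>r\<close>, because some upper Minkowski content
  of dimension below 1 vanishes.

  Minkowski versus S-content. For a primitive \<open>V\<close> of a nonincreasing \<open>s\<close>, power laws for \<open>V\<close> and for
  \<open>s\<close> are equivalent. From \<open>s\<close> to \<open>V\<close> one sums the increments of \<open>V\<close> along the geometric sequence
  \<open>q ^ n * r\<close>; from \<open>V\<close> to \<open>s\<close> one compares \<open>s r\<close> with the difference quotient of \<open>V\<close> between \<open>r\<close> and
  \<open>K * r\<close>, as in the monotone density theorem. In both directions the constant comes from
  \<open>(K powr p - 1) / (K - 1) \<longlonglongrightarrow> p\<close> as \<open>K \<longlonglongrightarrow> 1\<close>, with \<open>p = 1 - D\<close>; for bounds alone one fixed large \<open>K\<close>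
  is enough. This is the locale \<open>antitone_density\<close>.

  S-content versus lengths. The counting function \<open>x \<mapsto> card {j. l j > x}\<close> and the sequence \<open>l\<close> are
  generalized inverses of each other, so that \<open>(1 + card {j. l j > x}) * x powr D\<close> as \<open>x \<longlonglongrightarrow> 0\<close> and
  \<open>j * l j powr D\<close> as \<open>j \<longlonglongrightarrow> \<infinity>\<close> have the same bounds and the same limits. This is the locale
  \<open>length_sequence\<close>.

  The passage between the contents, which are built from Hausdorff measures, and \<open>V\<close> and \<open>s\<close> needs that
  the Hausdorff measure of dimension 1 is Lebesgue measure on compact sets of reals, and that the
  Hausdorff measure of dimension 0 counts the points of a finite set.
\<close>

section \<open>Hausdorff measures of dimension 0 and 1\<close>

lemma hausdorff_premeasure_le_cover:
  assumes "A \<subseteq> (\<Union>i. U i)" and "\<And>i. bounded (U i)" and "\<And>i. diameter (U i) \<le> \<delta>"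
  shows "hausdorff_premeasure t \<delta> A \<le> (\<Sum>i::nat. hausdorff_gauge t (U i))"
  unfolding hausdorff_premeasure_def using assms by (intro INF_lower) auto

text \<open>
  Singletons form a cover of the right weight. Conversely, once \<open>\<delta>\<close> is smaller than all distances
  between points of \<open>A\<close>, a member of a cover contains at most one point of \<open>A\<close>.
\<close>

lemma hausdorff_measure_0_finite:
  fixes A :: "'a::metric_space set"
  assumes "finite A"
  shows "hausdorff_measure 0 A = of_nat (card A)"
proof (rule antisym)
  obtain f where f: "bij_betw f {0..<card A} A"
    using ex_bij_betw_nat_finite[OF assms] by blast
  define U where "U = (\<lambda>i. if i < card A then {f i} else {})"
  show "hausdorff_measure 0 A \<le> of_nat (card A)"
    unfolding hausdorff_measure_def
  proof (rule SUP_least)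
    fix \<delta> :: real assume "\<delta> \<in> {0<..}"
    have "hausdorff_premeasure 0 \<delta> A \<le> (\<Sum>i. hausdorff_gauge 0 (U i))"
    proof (rule hausdorff_premeasure_le_cover)
      show "A \<subseteq> (\<Union>i. U i)"
      proof
        fix x assume "x \<in> A"
        then obtain i where "i < card A" "x = f i"
          using f by (fastforce simp: bij_betw_def)
        then show "x \<in> (\<Union>i. U i)" by (auto simp: U_def)
      qed
    qed (use \<open>\<delta> \<in> {0<..}\<close> in \<open>auto simp: U_def\<close>)
    also have "\<dots> = (\<Sum>i<card A. hausdorff_gauge 0 (U i))"
      by (rule suminf_finite) (auto simp: U_def hausdorff_gauge_def)
    also have "\<dots> = of_nat (card A)"
      by (simp add: U_def hausdorff_gauge_def)
    finally show "hausdorff_premeasure 0 \<delta> A \<le> of_nat (card A)" .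
  qed
next
  \<comment> \<open>The element 1 keeps \<open>P\<close> nonempty when \<open>A\<close> has at most one point.\<close>
  define P where "P = insert 1 ((\<lambda>(x, y). dist x y) ` {p \<in> A \<times> A. fst p \<noteq> snd p})"
  have P: "finite P" "P \<noteq> {}" "\<And>d. d \<in> P \<Longrightarrow> 0 < d"
    using assms by (auto simp: P_def)
  define \<delta> where "\<delta> = Min P / 2"
  have "0 < Min P" using P by simp
  have sep: "\<delta> < dist x y" if "x \<in> A" "y \<in> A" "x \<noteq> y" for x y
  proof -
    have "dist x y \<in> P" using that by (force simp: P_def)
    then have "Min P \<le> dist x y" using P by simp
    then show ?thesis using \<open>0 < Min P\<close> by (simp add: \<delta>_def)
  qed
  have "of_nat (card A) \<le> hausdorff_premeasure 0 \<delta> A"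
    unfolding hausdorff_premeasure_def
  proof (rule INF_greatest)
    fix U :: "nat \<Rightarrow> 'a set"
    assume "U \<in> {U. A \<subseteq> (\<Union>i. U i) \<and> (\<forall>i. bounded (U i) \<and> diameter (U i) \<le> \<delta>)}"
    then have cov: "A \<subseteq> (\<Union>i. U i)" and U: "\<And>i. bounded (U i)" "\<And>i. diameter (U i) \<le> \<delta>"
      by auto
    have "\<forall>x\<in>A. \<exists>i. x \<in> U i" using cov by auto
    then obtain g where g: "\<And>x. x \<in> A \<Longrightarrow> x \<in> U (g x)"
      using bchoice[of A "\<lambda>x i. x \<in> U i"] by blast
    have "inj_on g A"
    proof (rule inj_onI, rule ccontr)
      fix x y assume xy: "x \<in> A" "y \<in> A" "g x = g y" "x \<noteq> y"
      then have "dist x y \<le> diameter (U (g x))"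
        using g[of x] g[of y] U(1) by (intro diameter_bounded_bound) auto
      then show False using sep[of x y] xy U(2)[of "g x"] by linarith
    qed
    have "of_nat (card A) = (\<Sum>i\<in>g ` A. hausdorff_gauge 0 (U i))"
    proof -
      have "hausdorff_gauge 0 (U i) = 1" if "i \<in> g ` A" for i
        using that g by (auto simp: hausdorff_gauge_def)
      then show ?thesis using card_image[OF \<open>inj_on g A\<close>] by simp
    qed
    also have "\<dots> \<le> (\<Sum>i. hausdorff_gauge 0 (U i))"
      using assms by (intro sum_le_suminf) auto
    finally show "of_nat (card A) \<le> (\<Sum>i. hausdorff_gauge 0 (U i))" .
  qed
  also have "\<dots> \<le> hausdorff_measure 0 A"
    unfolding hausdorff_measure_def using \<open>0 < Min P\<close> by (intro SUP_upper) (auto simp: \<delta>_def)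
  finally show "of_nat (card A) \<le> hausdorff_measure 0 A" .
qed

lemma hausdorff_gauge_1:
  "hausdorff_gauge 1 U = ennreal (diameter U)" if "bounded U"
  using that diameter_ge_0[of U] by (auto simp: hausdorff_gauge_def)

text \<open>
  A set \<open>U\<close> of reals is contained in a closed interval of length \<open>diameter U\<close> that starts at \<open>Inf U\<close>,
  so every cover is at least as heavy as the Lebesgue measure of the union of these intervals.
\<close>

lemma emeasure_le_hausdorff_measure_1:
  fixes A :: "real set"
  assumes "A \<in> sets borel"
  shows "emeasure lborel A \<le> hausdorff_measure 1 A"
proof -
  have "emeasure lborel A \<le> hausdorff_premeasure 1 1 A"
    unfolding hausdorff_premeasure_def
  proof (rule INF_greatest)
    fix U :: "nat \<Rightarrow> real set"
    assume "U \<in> {U. A \<subseteq> (\<Union>i. U i) \<and> (\<forall>i. bounded (U i) \<and> diameter (U i) \<le> 1)}"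
    then have cov: "A \<subseteq> (\<Union>i. U i)" and U: "\<And>i. bounded (U i)"
      by auto
    define J where "J = (\<lambda>i. if U i = {} then {} else {Inf (U i)..Inf (U i) + diameter (U i)})"
    have UJ: "U i \<subseteq> J i" for i
    proof
      fix x assume x: "x \<in> U i"
      have "Inf (U i) \<le> x"
        using x U[of i] by (intro cInf_lower bounded_imp_bdd_below)
      moreover have "x - diameter (U i) \<le> Inf (U i)"
      proof (rule cInf_greatest)
        fix y assume "y \<in> U i"
        then have "dist x y \<le> diameter (U i)"
          using x U[of i] by (intro diameter_bounded_bound)
        then show "x - diameter (U i) \<le> y" by (simp add: dist_real_def)
      qed (use x in auto)
      ultimately show "x \<in> J i" using x by (auto simp: J_def)
    qed
    have J: "J i \<in> sets borel" for i by (auto simp: J_def)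
    have "emeasure lborel A \<le> emeasure lborel (\<Union>i. J i)"
      using cov UJ J by (intro emeasure_mono) (blast, simp)
    also have "\<dots> \<le> (\<Sum>i. emeasure lborel (J i))"
      using J by (intro emeasure_subadditive_countably) auto
    also have "\<dots> \<le> (\<Sum>i. hausdorff_gauge 1 (U i))"
      using U by (intro suminf_le) (auto simp: hausdorff_gauge_1 J_def diameter_ge_0)
    finally show "emeasure lborel A \<le> (\<Sum>i. hausdorff_gauge 1 (U i))" .
  qed
  also have "\<dots> \<le> hausdorff_measure 1 A"
    unfolding hausdorff_measure_def by (intro SUP_upper) auto
  finally show ?thesis .
qed

lemma closed_infdist_le: "closed {x. infdist x A \<le> h}"
  by (intro closed_Collect_le continuous_intros)

text \<open>
  The cells of the grid of mesh \<open>h\<close> that meet \<open>A\<close> cover \<open>A\<close>. They are disjoint, each weighs as much as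
  its Lebesgue measure, and they stay within distance \<open>h\<close> of \<open>A\<close>.
\<close>

lemma hausdorff_premeasure_1_le_neighbourhood:
  fixes A :: "real set"
  assumes "0 < h" "h \<le> \<delta>" "A \<noteq> {}"
  shows "hausdorff_premeasure 1 \<delta> A \<le> emeasure lborel {x. infdist x A \<le> h}"
proof -
  define cell where "cell = (\<lambda>k::int. {real_of_int k * h..<(real_of_int k + 1) * h})"
  define U where
    "U = (\<lambda>i. if cell (int_decode i) \<inter> A = {} then {} else cell (int_decode i))"
  have dist_cell: "dist x y \<le> h" if "x \<in> cell k" "y \<in> cell k" for x y k
    using that by (auto simp: cell_def dist_real_def algebra_simps)
  have mem_cell: "x \<in> cell \<lfloor>x / h\<rfloor>" for x
  proof -
    have "real_of_int \<lfloor>x / h\<rfloor> \<le> x / h" "x / h < real_of_int \<lfloor>x / h\<rfloor> + 1"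
      by linarith+
    then show ?thesis
      using \<open>0 < h\<close> by (simp only: cell_def pos_le_divide_eq pos_divide_less_eq) simp
  qed
  have cell_unique: "k = \<lfloor>x / h\<rfloor>" if "x \<in> cell k" for x k
  proof -
    have "real_of_int k \<le> x / h" "x / h < real_of_int k + 1"
      using that \<open>0 < h\<close> by (simp_all add: cell_def field_simps)
    then show ?thesis using floor_unique by metis
  qed
  have U_sub: "U i \<subseteq> cell (int_decode i)" for i
    by (simp add: U_def)
  have diam: "diameter (U i) \<le> h" for i
  proof (rule diameter_le)
    fix x y assume "x \<in> U i" "y \<in> U i"
    then show "norm (x - y) \<le> h"
      using U_sub[of i] dist_cell[of x "int_decode i" y] by (auto simp: dist_norm)
  qed (use \<open>0 < h\<close> in simp)
  have "hausdorff_premeasure 1 \<delta> A \<le> (\<Sum>i. hausdorff_gauge 1 (U i))"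
  proof (rule hausdorff_premeasure_le_cover)
    show "A \<subseteq> (\<Union>i. U i)"
    proof
      fix x assume "x \<in> A"
      then have "x \<in> U (int_encode \<lfloor>x / h\<rfloor>)"
        using mem_cell[of x] by (auto simp: U_def)
      then show "x \<in> (\<Union>i. U i)" by blast
    qed
    show "bounded (U i)" for i
      by (auto simp: U_def cell_def)
    show "diameter (U i) \<le> \<delta>" for i
      using diam[of i] \<open>h \<le> \<delta>\<close> by linarith
  qed
  also have "\<dots> \<le> (\<Sum>i. emeasure lborel (U i))"
  proof (intro suminf_le)
    fix i
    show "hausdorff_gauge 1 (U i) \<le> emeasure lborel (U i)"
    proof (cases "U i = {}")
      case True then show ?thesis by (simp add: hausdorff_gauge_def)
    next
      case False
      then have Ui: "U i = cell (int_decode i)" by (auto simp: U_def split: if_splits)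
      have "bounded (U i)" by (auto simp: U_def cell_def)
      moreover have "emeasure lborel (U i) = ennreal h"
        using \<open>0 < h\<close> by (simp add: Ui cell_def algebra_simps)
      ultimately show ?thesis
        using diam[of i] by (simp add: hausdorff_gauge_1 ennreal_leI)
    qed
  qed auto
  also have "\<dots> = emeasure lborel (\<Union>i. U i)"
  proof (rule suminf_emeasure)
    show "range U \<subseteq> sets lborel" by (auto simp: U_def cell_def)
    have "U i \<inter> U j = {}" if "i \<noteq> j" for i j
    proof -
      have "int_decode i = int_decode j" if "x \<in> U i" "x \<in> U j" for x
        using that U_sub cell_unique[of x "int_decode i"] cell_unique[of x "int_decode j"]
        by (metis subsetD)
      then show ?thesis using that by (auto simp: int_decode_eq)
    qed
    then show "disjoint_family U" by (auto simp: disjoint_family_on_def)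
  qed
  also have "\<dots> \<le> emeasure lborel {x. infdist x A \<le> h}"
  proof (rule emeasure_mono)
    show "(\<Union>i. U i) \<subseteq> {x. infdist x A \<le> h}"
    proof
      fix x assume "x \<in> (\<Union>i. U i)"
      then obtain i y where "x \<in> cell (int_decode i)" "y \<in> cell (int_decode i)" "y \<in> A"
        by (auto simp: U_def split: if_splits)
      then have "infdist x A \<le> h"
        using infdist_le2[of y A x h] dist_cell by blast
      then show "x \<in> {x. infdist x A \<le> h}" by simp
    qed
    show "{x. infdist x A \<le> h} \<in> sets lborel"
      by (simp add: borel_closed closed_infdist_le)
  qed
  finally show ?thesis .
qed

lemma compact_infdist_cball:
  fixes A :: "real set"
  assumes "compact A" "A \<noteq> {}"
  shows "compact {x. infdist x A \<le> h}"
proof -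
  have "bounded {x. infdist x A \<le> h}"
  proof -
    obtain B where B: "\<And>a. a \<in> A \<Longrightarrow> \<bar>a\<bar> \<le> B"
      using compact_imp_bounded[OF \<open>compact A\<close>] by (auto simp: bounded_iff)
    have "\<bar>x\<bar> \<le> B + h" if "infdist x A \<le> h" for x
    proof -
      obtain a where "a \<in> A" "infdist x A = dist x a"
        using infdist_attains_inf[of A x] assms compact_imp_closed by blast
      then show ?thesis using that B[of a] by (auto simp: dist_real_def)
    qed
    then show ?thesis by (intro boundedI[of _ "B + h"]) simp
  qed
  then show ?thesis by (simp add: compact_eq_bounded_closed closed_infdist_le)
qed

text \<open>
  For compact \<open>A\<close> the neighbourhoods that bound the premeasure from above shrink to \<open>A\<close>, and their
  Lebesgue measures are finite, so continuity from above makes the two bounds meet.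
\<close>

lemma hausdorff_measure_1_compact:
  fixes A :: "real set"
  assumes "compact A"
  shows "hausdorff_measure 1 A = emeasure lborel A"
proof (rule antisym)
  show "emeasure lborel A \<le> hausdorff_measure 1 A"
    using assms by (intro emeasure_le_hausdorff_measure_1) (simp add: borel_compact)
  show "hausdorff_measure 1 A \<le> emeasure lborel A"
  proof (cases "A = {}")
    case True
    have "hausdorff_premeasure 1 \<delta> A \<le> (\<Sum>i::nat. hausdorff_gauge 1 ({} :: real set))"
      if "0 < \<delta>" for \<delta>
      using True that by (intro hausdorff_premeasure_le_cover) auto
    then show ?thesis
      by (auto simp: hausdorff_measure_def hausdorff_gauge_def intro!: SUP_least)
  next
    case False
    define N where "N = (\<lambda>n::nat. {x. infdist x A \<le> 1 / real (Suc n)})"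
    have N_compact: "compact (N n)" for n
      unfolding N_def using assms False by (rule compact_infdist_cball)
    have "(\<lambda>n. emeasure lborel (N n)) \<longlonglongrightarrow> emeasure lborel (\<Inter>n. N n)"
    proof (rule Lim_emeasure_decseq)
      show "range N \<subseteq> sets lborel" using N_compact by (auto simp: borel_compact)
      have "1 / real (Suc (Suc n)) \<le> 1 / real (Suc n)" for n
        by (intro frac_le) auto
      then show "decseq N"
        unfolding N_def by (intro decseq_SucI) (blast intro: order_trans)
      show "emeasure lborel (N n) \<noteq> \<infinity>" for n
        using emeasure_compact_finite[OF N_compact[of n]] by (simp add: less_top)
    qed
    also have "(\<Inter>n. N n) = A"
    proof -
      have "infdist x A = 0" if "\<And>n. infdist x A \<le> 1 / real (Suc n)" for x
      proof -
        have "infdist x A \<le> 0"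
          by (rule LIMSEQ_le_const[OF LIMSEQ_Suc[OF lim_1_over_n]]) (use that in auto)
        then show ?thesis using infdist_nonneg[of x A] by linarith
      qed
      moreover have "infdist x A \<le> 1 / real (Suc n)" if "x \<in> A" for x n
        using that by simp
      ultimately have "x \<in> (\<Inter>n. N n) \<longleftrightarrow> x \<in> A" for x
        unfolding N_def using in_closed_iff_infdist_zero[OF compact_imp_closed[OF assms] False]
        by blast
      then show ?thesis by blast
    qed
    finally have lim: "(\<lambda>n. emeasure lborel (N n)) \<longlonglongrightarrow> emeasure lborel A" .
    show ?thesis
      unfolding hausdorff_measure_def
    proof (rule SUP_least)
      fix \<delta> :: real assume "\<delta> \<in> {0<..}"
      then obtain n0 where n0: "1 / real (Suc n0) < \<delta>"
        using nat_approx_posE[of \<delta>] by auto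
      show "hausdorff_premeasure 1 \<delta> A \<le> emeasure lborel A"
      proof (rule LIMSEQ_le_const[OF lim], intro exI allI impI)
        fix n assume "n0 \<le> n"
        then have "1 / real (Suc n) \<le> 1 / real (Suc n0)" by (intro frac_le) auto
        then show "hausdorff_premeasure 1 \<delta> A \<le> emeasure lborel (N n)"
          unfolding N_def using n0 False
          by (intro hausdorff_premeasure_1_le_neighbourhood) auto
      qed
    qed
  qed
qed

section \<open>Gaps of a compact set and its parallel sets\<close>

text \<open>
  A bounded component is an open interval; if an endpoint were outside \<open>F\<close>, adding it would give a
  larger connected subset of the complement.
\<close>

lemma bounded_component_compl_eq_gap:
  fixes F U :: "real set"
  assumes "closed F" "U \<in> components (- F)" "bounded U"
  obtains a b where "a < b" "a \<in> F" "b \<in> F" "U = {a<..<b}"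
proof -
  have ne: "U \<noteq> {}" and sub: "U \<subseteq> - F" and conn: "connected U" and "open U"
    using in_components_nonempty[OF assms(2)] in_components_subset[OF assms(2)]
      in_components_connected[OF assms(2)] open_components[OF _ assms(2)] assms(1)
    by (simp_all add: open_Compl)
  define a b where "a = Inf U" and "b = Sup U"
  note bdd = bounded_imp_bdd_below[OF \<open>bounded U\<close>] bounded_imp_bdd_above[OF \<open>bounded U\<close>]
  have U: "U = {a<..<b}"
  proof (intro set_eqI iffI)
    fix x assume "x \<in> U"
    then obtain e where "0 < e" and e: "cball x e \<subseteq> U"
      using \<open>open U\<close> open_contains_cball by blast
    then have "x - e \<in> U" "x + e \<in> U" by (auto simp: dist_real_def)
    then have "a \<le> x - e" "x + e \<le> b"
      unfolding a_def b_def using bdd by (auto intro: cInf_lower cSup_upper)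
    then show "x \<in> {a<..<b}" using \<open>0 < e\<close> by auto
  next
    fix x assume "x \<in> {a<..<b}"
    then obtain y z where "y \<in> U" "y < x" "z \<in> U" "x < z"
      unfolding a_def b_def using ne cInf_lessD[of U x] less_cSupD[of U x] by auto
    then show "x \<in> U" using conn unfolding connected_iff_interval by (meson less_imp_le)
  qed
  with ne have "a < b" by auto
  have maximal: "T \<subseteq> U" if "connected T" "T \<subseteq> - F" "U \<inter> T \<noteq> {}" for T
    using assms(2) that by (rule components_maximal)
  have "a \<in> F"
  proof (rule ccontr)
    assume "a \<notin> F"
    then have "{a..<b} \<subseteq> - F" using sub unfolding U by force
    moreover have "(a + b) / 2 \<in> U \<inter> {a..<b}" using \<open>a < b\<close> unfolding U by simp
    ultimately have "{a..<b} \<subseteq> U" by (intro maximal) (simp, blast+)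
    then show False using \<open>a < b\<close> unfolding U by force
  qed
  moreover have "b \<in> F"
  proof (rule ccontr)
    assume "b \<notin> F"
    then have "{a<..b} \<subseteq> - F" using sub unfolding U by force
    moreover have "(a + b) / 2 \<in> U \<inter> {a<..b}" using \<open>a < b\<close> unfolding U by simp
    ultimately have "{a<..b} \<subseteq> U" by (intro maximal) (simp, blast+)
    then show False using \<open>a < b\<close> unfolding U by force
  qed
  ultimately show thesis using that \<open>a < b\<close> U by blast
qed

lemma closure_UN_finite: "finite A \<Longrightarrow> closure (\<Union>x\<in>A. S x) = (\<Union>x\<in>A. closure (S x))"
  by (induction A rule: finite_induct) auto

text \<open>
  The bounded complementary intervals of \<open>F\<close>, given by their endpoints and indexed by \<open>j \<ge> 1\<close>
  as in a fractal string, but in any order.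
\<close>

locale gap_enumeration =
  fixes F :: "real set" and a b :: "nat \<Rightarrow> real"
  assumes compact: "compact F"
    and less: "1 \<le> j \<Longrightarrow> a j < b j"
    and left_end: "1 \<le> j \<Longrightarrow> a j \<in> F"
    and right_end: "1 \<le> j \<Longrightarrow> b j \<in> F"
    and gap: "1 \<le> j \<Longrightarrow> {a j<..<b j} \<inter> F = {}"
    and disjoint: "disjoint_family_on (\<lambda>j. {a j<..<b j}) {1..}"
    and cover: "{Inf F..Sup F} - F \<subseteq> (\<Union>j\<in>{1..}. {a j<..<b j})"
begin

text \<open>
  The gaps that the parallel set of radius \<open>r\<close> does not fill.
\<close>

definition long :: "real \<Rightarrow> nat set" where
  "long r = {j. 1 \<le> j \<and> 2 * r < b j - a j}"

lemma nonempty: "F \<noteq> {}"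
  using left_end[of 1] by auto

lemma Inf_in: "Inf F \<in> F" and Sup_in: "Sup F \<in> F"
  using compact nonempty
  by (auto intro!: closed_contains_Inf closed_contains_Sup
      simp: compact_imp_closed bounded_imp_bdd_below bounded_imp_bdd_above compact_imp_bounded)

lemma bounds: "x \<in> F \<Longrightarrow> Inf F \<le> x \<and> x \<le> Sup F"
  using compact
  by (auto intro!: cInf_lower cSup_upper
      simp: bounded_imp_bdd_below bounded_imp_bdd_above compact_imp_bounded)

lemma disjointD: "1 \<le> i \<Longrightarrow> 1 \<le> j \<Longrightarrow> x \<in> {a i<..<b i} \<Longrightarrow> x \<in> {a j<..<b j} \<Longrightarrow> i = j"
  using disjoint unfolding disjoint_family_on_def by blast

text \<open>
  Used with \<open>r = 0\<close> to bound the number of long gaps, and with \<open>r > 0\<close> for the volume of parallel sets.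
\<close>

lemma measure_shrunk_gaps:
  assumes "finite K" "K \<subseteq> {1..}" "0 \<le> r" "\<And>j. j \<in> K \<Longrightarrow> 2 * r \<le> b j - a j"
  shows "measure lborel (\<Union>j\<in>K. {a j + r<..<b j - r}) = (\<Sum>j\<in>K. b j - a j - 2 * r)"
proof -
  have "measure lborel (\<Union>j\<in>K. {a j + r<..<b j - r})
      = (\<Sum>j\<in>K. measure lborel {a j + r<..<b j - r})"
  proof (rule measure_finite_Union)
    show "disjoint_family_on (\<lambda>j. {a j + r<..<b j - r}) K"
      unfolding disjoint_family_on_def
    proof (intro ballI impI equals0I)
      fix i j x assume "i \<in> K" "j \<in> K" "i \<noteq> j" "x \<in> {a i + r<..<b i - r} \<inter> {a j + r<..<b j - r}"
      then show False using disjointD[of i j x] assms(2,3) by force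
    qed
    show "emeasure lborel {a j + r<..<b j - r} \<noteq> \<infinity>" if "j \<in> K" for j
      using assms(4)[OF that] by simp
  qed (use assms in auto)
  also have "\<dots> = (\<Sum>j\<in>K. b j - a j - 2 * r)"
    using assms(4) by (intro sum.cong) (force simp: measure_def)+
  finally show ?thesis .
qed

text \<open>
  Disjoint gaps longer than \<open>2 * r\<close> lie in an interval of length \<open>Sup F - Inf F\<close>, which leaves room
  for at most \<open>(Sup F - Inf F) / (2 * r)\<close> of them.
\<close>

lemma finite_long:
  assumes "0 < r"
  shows "finite (long r)"
proof -
  have "card K \<le> nat \<lceil>(Sup F - Inf F) / (2 * r)\<rceil>" if K: "finite K" "K \<subseteq> long r" for K
  proof -
    have K1: "1 \<le> j" if "j \<in> K" for j using K that by (auto simp: long_def)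
    have "real (card K) * (2 * r) \<le> (\<Sum>j\<in>K. b j - a j - 2 * 0)"
      using K by (intro sum_bounded_below) (auto simp: long_def)
    also have "\<dots> = measure lborel (\<Union>j\<in>K. {a j + 0<..<b j - 0})"
      using K K1 less by (intro measure_shrunk_gaps[symmetric]) (auto intro: less_imp_le)
    also have "\<dots> \<le> measure lborel {Inf F..Sup F}"
    proof (rule measure_mono_fmeasurable)
      show "(\<Union>j\<in>K. {a j + 0<..<b j - 0}) \<subseteq> {Inf F..Sup F}"
      proof
        fix x assume "x \<in> (\<Union>j\<in>K. {a j + 0<..<b j - 0})"
        then obtain j where "j \<in> K" "a j < x" "x < b j" by auto
        then show "x \<in> {Inf F..Sup F}"
          using K1[of j] bounds[OF left_end[of j]] bounds[OF right_end[of j]] by auto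
      qed
    qed (auto simp: emeasure_lborel_Icc_eq intro: fmeasurableI)
    also have "\<dots> = Sup F - Inf F"
      using bounds[OF Inf_in] by simp
    finally have "real (card K) \<le> (Sup F - Inf F) / (2 * r)"
      using \<open>0 < r\<close> by (simp add: pos_le_divide_eq)
    then show ?thesis by linarith
  qed
  then show ?thesis by (meson finite_if_finite_subsets_card_bdd)
qed

text \<open>
  Within a gap the nearest point of \<open>F\<close> is one of the two endpoints, so the points of the gap at
  distance more than \<open>r\<close> are those further than \<open>r\<close> from both ends.
\<close>

lemma parallel_set_eq:
  assumes "0 < r"
  shows "parallel_set F r = {Inf F - r..Sup F + r} - (\<Union>j\<in>long r. {a j + r<..<b j - r})"
proof (intro set_eqI iffI)
  fix z assume "z \<in> parallel_set F r"
  then have "infdist z F \<le> r" by (simp add: parallel_set_def)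
  moreover obtain y where "y \<in> F" "infdist z F = dist z y"
    using infdist_attains_inf[OF compact_imp_closed[OF compact] nonempty] by blast
  ultimately have y: "y \<in> F" "\<bar>z - y\<bar> \<le> r" by (simp_all add: dist_real_def)
  have "z \<notin> {a j + r<..<b j - r}" if "j \<in> long r" for j
  proof
    assume "z \<in> {a j + r<..<b j - r}"
    then have "y \<in> {a j<..<b j}" using y by auto
    then show False using gap[of j] that y by (auto simp: long_def)
  qed
  then show "z \<in> {Inf F - r..Sup F + r} - (\<Union>j\<in>long r. {a j + r<..<b j - r})"
    using y bounds[of y] by auto
next
  fix z assume z: "z \<in> {Inf F - r..Sup F + r} - (\<Union>j\<in>long r. {a j + r<..<b j - r})"
  have near: "z \<in> parallel_set F r" if "y \<in> F" "\<bar>z - y\<bar> \<le> r" for y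
    using infdist_le2[of y F z r] that by (simp add: parallel_set_def dist_real_def)
  consider "z < Inf F" | "Sup F < z" | "z \<in> F" | "z \<in> {Inf F..Sup F} - F" by force
  then show "z \<in> parallel_set F r"
  proof cases
    case 1 then show ?thesis using z by (intro near[OF Inf_in]) auto
  next
    case 2 then show ?thesis using z by (intro near[OF Sup_in]) auto
  next
    case 3 then show ?thesis using \<open>0 < r\<close> by (intro near) auto
  next
    case 4
    then obtain j where j: "1 \<le> j" "a j < z" "z < b j" using cover by force
    have "z \<le> a j + r \<or> b j - r \<le> z"
    proof (cases "j \<in> long r")
      case True
      then have "z \<notin> {a j + r<..<b j - r}" using z by blast
      then show ?thesis by auto
    next
      case False
      then show ?thesis using j by (auto simp: long_def)
    qed
    then show ?thesis using near[OF left_end[of j]] near[OF right_end[of j]] j by auto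
  qed
qed

lemma compact_parallel_set: "compact (parallel_set F r)"
  unfolding parallel_set_def using compact nonempty by (rule compact_infdist_cball)

lemma measure_parallel_set:
  assumes "0 < r"
  shows "measure lborel (parallel_set F r)
    = Sup F - Inf F + 2 * r - (\<Sum>j\<in>long r. b j - a j - 2 * r)"
proof -
  have "measure lborel (parallel_set F r)
      = measure lborel {Inf F - r..Sup F + r}
        - measure lborel (\<Union>j\<in>long r. {a j + r<..<b j - r})"
    unfolding parallel_set_eq[OF assms]
  proof (rule measure_Diff)
    show "(\<Union>j\<in>long r. {a j + r<..<b j - r}) \<subseteq> {Inf F - r..Sup F + r}"
    proof
      fix x assume "x \<in> (\<Union>j\<in>long r. {a j + r<..<b j - r})"
      then obtain j where "1 \<le> j" "a j + r < x" "x < b j - r" by (auto simp: long_def)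
      then show "x \<in> {Inf F - r..Sup F + r}"
        using bounds[OF left_end[of j]] bounds[OF right_end[of j]] assms by auto
    qed
  qed (auto simp: emeasure_lborel_Icc_eq)
  also have "measure lborel (\<Union>j\<in>long r. {a j + r<..<b j - r})
      = (\<Sum>j\<in>long r. b j - a j - 2 * r)"
    using assms finite_long by (intro measure_shrunk_gaps) (auto simp: long_def)
  finally show ?thesis using bounds[OF Inf_in] assms by simp
qed

text \<open>
  The frontier is the part of the closed parallel set that lies in the closure of its complement. The
  strict inequality in the definition of \<open>long\<close> matters: a gap of length exactly \<open>2 * r\<close> has its
  midpoint at distance \<open>r\<close> from \<open>F\<close>, yet the midpoint is interior to the parallel set.
\<close>

lemma frontier_parallel_set:
  assumes "0 < r"
  shows "frontier (parallel_set F r)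
    = {Inf F - r, Sup F + r} \<union> (\<Union>j\<in>long r. {a j + r, b j - r})"
proof -
  define G where "G = (\<Union>j\<in>long r. {a j + r<..<b j - r})"
  have compl: "- parallel_set F r = {..<Inf F - r} \<union> {Sup F + r<..} \<union> G"
  proof -
    have "G \<subseteq> {Inf F - r..Sup F + r}"
    proof
      fix x assume "x \<in> G"
      then obtain j where "j \<in> long r" "a j + r < x" "x < b j - r" unfolding G_def by auto
      then have "1 \<le> j" "a j + r < x" "x < b j - r" by (auto simp: long_def)
      then show "x \<in> {Inf F - r..Sup F + r}"
        using bounds[OF left_end[of j]] bounds[OF right_end[of j]] assms by auto
    qed
    then show ?thesis unfolding parallel_set_eq[OF assms] G_def[symmetric] by force
  qed
  have clG: "closure G = (\<Union>j\<in>long r. {a j + r..b j - r})"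
  proof -
    have "closure G = (\<Union>j\<in>long r. closure {a j + r<..<b j - r})"
      unfolding G_def using finite_long[OF assms] by (rule closure_UN_finite)
    also have "\<dots> = (\<Union>j\<in>long r. {a j + r..b j - r})"
      by (intro SUP_cong) (auto simp: long_def closure_greaterThanLessThan)
    finally show ?thesis .
  qed
  have "frontier (parallel_set F r) = parallel_set F r \<inter> closure (- parallel_set F r)"
    using compact_imp_closed[OF compact_parallel_set] by (simp add: frontier_closures)
  also have "closure (- parallel_set F r)
      = {..Inf F - r} \<union> {Sup F + r..} \<union> (\<Union>j\<in>long r. {a j + r..b j - r})"
    unfolding compl by (simp add: clG)
  also have "parallel_set F r \<inter> \<dots> = {Inf F - r, Sup F + r} \<union> (\<Union>j\<in>long r. {a j + r, b j - r})"
    (is "_ = ?R")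
  proof
    show "parallel_set F r \<inter> ({..Inf F - r} \<union> {Sup F + r..} \<union> (\<Union>j\<in>long r. {a j + r..b j - r}))
        \<subseteq> ?R"
      unfolding parallel_set_eq[OF assms] by force
    have near: "x \<in> parallel_set F r" if "y \<in> F" "\<bar>x - y\<bar> = r" for x y
      using infdist_le2[of y F x r] that by (simp add: parallel_set_def dist_real_def)
    have "?R \<subseteq> parallel_set F r"
      using near[OF Inf_in] near[OF Sup_in] near[OF left_end] near[OF right_end] assms
      by (auto simp: long_def)
    then show "?R \<subseteq> parallel_set F r
        \<inter> ({..Inf F - r} \<union> {Sup F + r..} \<union> (\<Union>j\<in>long r. {a j + r..b j - r}))"
      by (auto simp: long_def)
  qed
  finally show ?thesis .
qed

text \<open>
  No two of the listed points coincide: those from long gaps lie inside pairwise disjoint gaps, and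
  \<open>Inf F - r\<close> and \<open>Sup F + r\<close> lie outside the convex hull of \<open>F\<close>.
\<close>

lemma card_frontier_parallel_set:
  assumes "0 < r"
  shows "finite (frontier (parallel_set F r))"
    and "card (frontier (parallel_set F r)) = 2 + 2 * card (long r)"
proof -
  define E where "E = (\<lambda>j. {a j + r, b j - r})"
  have E: "E j \<subseteq> {a j<..<b j}" "card (E j) = 2" if "j \<in> long r" for j
  proof -
    have "1 \<le> j" "a j + r < b j - r" using that by (auto simp: long_def)
    then show "E j \<subseteq> {a j<..<b j}" "card (E j) = 2" using assms by (auto simp: E_def)
  qed
  have "card (\<Union>j\<in>long r. E j) = (\<Sum>j\<in>long r. card (E j))"
  proof (rule card_UN_disjoint)
    show "\<forall>i\<in>long r. \<forall>j\<in>long r. i \<noteq> j \<longrightarrow> E i \<inter> E j = {}"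
    proof (intro ballI impI equals0I)
      fix i j x assume "i \<in> long r" "j \<in> long r" "i \<noteq> j" "x \<in> E i \<inter> E j"
      moreover from this have "x \<in> {a i<..<b i}" "x \<in> {a j<..<b j}" using E(1) by blast+
      ultimately show False using disjointD[of i j x] by (auto simp: long_def)
    qed
  qed (use finite_long[OF assms] in \<open>auto simp: E_def\<close>)
  also have "\<dots> = 2 * card (long r)"
    using E(2) by simp
  finally have 1: "card (\<Union>j\<in>long r. E j) = 2 * card (long r)" .
  have "x \<in> {Inf F..Sup F}" if "x \<in> E j" "j \<in> long r" for x j
  proof -
    have "1 \<le> j" "x \<in> {a j<..<b j}"
      using E(1)[OF that(2)] that by (simp add: long_def, blast)
    then show ?thesis
      using bounds[OF left_end[of j]] bounds[OF right_end[of j]] by auto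
  qed
  then have "(\<Union>j\<in>long r. E j) \<subseteq> {Inf F..Sup F}" by blast
  then have 2: "{Inf F - r, Sup F + r} \<inter> (\<Union>j\<in>long r. E j) = {}"
    using assms by auto
  have 3: "card {Inf F - r, Sup F + r} = 2"
    using bounds[OF Inf_in] assms by simp
  have fr: "frontier (parallel_set F r) = {Inf F - r, Sup F + r} \<union> (\<Union>j\<in>long r. E j)"
    unfolding E_def by (rule frontier_parallel_set[OF assms])
  have fin: "finite (\<Union>j\<in>long r. E j)" using finite_long[OF assms] by (auto simp: E_def)
  show "finite (frontier (parallel_set F r))"
    unfolding fr using fin by simp
  show "card (frontier (parallel_set F r)) = 2 + 2 * card (long r)"
    unfolding fr using card_Un_disjoint[OF _ fin 2] 1 3 by simp
qed

lemma hausdorff_measure_1_parallel_set: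
  "hausdorff_measure 1 (parallel_set F r) = ennreal (measure lborel (parallel_set F r))"
  using emeasure_compact_finite[OF compact_parallel_set, of r]
  by (simp add: hausdorff_measure_1_compact[OF compact_parallel_set] emeasure_eq_ennreal_measure
      less_top)

lemma hausdorff_measure_0_frontier:
  assumes "0 < r"
  shows "hausdorff_measure 0 (frontier (parallel_set F r)) = ennreal (2 + 2 * real (card (long r)))"
proof -
  have "hausdorff_measure 0 (frontier (parallel_set F r)) = of_nat (2 + 2 * card (long r))"
    using card_frontier_parallel_set[OF assms] by (simp add: hausdorff_measure_0_finite)
  also have "\<dots> = ennreal (real (2 + 2 * card (long r)))"
    by (rule ennreal_of_nat_eq_real_of_nat)
  finally show ?thesis by simp
qed

text \<open>
  When the radius grows from \<open>r\<close> to \<open>R\<close>, the two outer ends contribute \<open>2 * (R - r)\<close>, and each gap long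
  at scale \<open>r\<close> is filled by a further \<open>min (b j - a j) (2 * R) - 2 * r\<close>. This is at most \<open>2 * (R - r)\<close>,
  with equality for the gaps that are still long at scale \<open>R\<close>.
\<close>

lemma measure_parallel_set_increment:
  assumes "0 < r" "r < R"
  shows "(R - r) * (2 + 2 * real (card (long R)))
      \<le> measure lborel (parallel_set F R) - measure lborel (parallel_set F r)"
    and "measure lborel (parallel_set F R) - measure lborel (parallel_set F r)
      \<le> (R - r) * (2 + 2 * real (card (long r)))"
proof -
  define w where "w = (\<lambda>j. b j - a j)"
  have sub: "long R \<subseteq> long r" using assms by (auto simp: long_def)
  note fin = finite_long[OF \<open>0 < r\<close>]
  define \<Delta> where "\<Delta> = (\<Sum>j\<in>long r. min (w j) (2 * R) - 2 * r)"
  have "(\<Sum>j\<in>long r. w j - 2 * r) - (\<Sum>j\<in>long R. w j - 2 * R) = \<Delta>"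
  proof -
    have "(\<Sum>j\<in>long R. w j - 2 * R) = (\<Sum>j\<in>long r. if j \<in> long R then w j - 2 * R else 0)"
      using fin sub by (simp add: sum.If_cases Int_absorb1)
    then have "(\<Sum>j\<in>long r. w j - 2 * r) - (\<Sum>j\<in>long R. w j - 2 * R)
        = (\<Sum>j\<in>long r. (w j - 2 * r) - (if j \<in> long R then w j - 2 * R else 0))"
      by (simp only: sum_subtractf)
    also have "\<dots> = \<Delta>"
      unfolding \<Delta>_def by (intro sum.cong) (auto simp: long_def w_def)
    finally show ?thesis .
  qed
  then have V: "measure lborel (parallel_set F R) - measure lborel (parallel_set F r)
      = 2 * (R - r) + \<Delta>"
    using assms by (simp add: measure_parallel_set w_def)
  have "\<Delta> \<le> real (card (long r)) * (2 * R - 2 * r)"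
    unfolding \<Delta>_def by (rule sum_bounded_above) auto
  moreover have "real (card (long R)) * (2 * R - 2 * r) \<le> \<Delta>"
  proof -
    have "real (card (long R)) * (2 * R - 2 * r) \<le> (\<Sum>j\<in>long R. min (w j) (2 * R) - 2 * r)"
      by (rule sum_bounded_below) (auto simp: long_def w_def)
    also have "\<dots> \<le> \<Delta>"
      unfolding \<Delta>_def using fin sub assms by (intro sum_mono2) (auto simp: long_def w_def)
    finally show ?thesis .
  qed
  ultimately show "(R - r) * (2 + 2 * real (card (long R)))
      \<le> measure lborel (parallel_set F R) - measure lborel (parallel_set F r)"
    and "measure lborel (parallel_set F R) - measure lborel (parallel_set F r)
      \<le> (R - r) * (2 + 2 * real (card (long r)))"
    unfolding V by (simp_all add: algebra_simps)
qed

end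

text \<open>
  An enumeration of components yields an enumeration of endpoints; it covers the convex hull of \<open>F\<close>
  up to \<open>F\<close>, since a component that meets the hull cannot pass the extreme points of \<open>F\<close>.
\<close>

lemma fractal_string_gap_enumeration:
  assumes "compact F" "fractal_string F l"
  obtains a b where "gap_enumeration F a b" "\<And>j. 1 \<le> j \<Longrightarrow> l j = b j - a j"
proof -
  obtain I where I: "bij_betw I {1..} {U \<in> components (- F). bounded U}"
    and l: "\<And>j. 1 \<le> j \<Longrightarrow> l j = measure lborel (I j)"
    using assms(2) by (auto simp: fractal_string_def)
  have comp: "I j \<in> components (- F)" "bounded (I j)" if "1 \<le> j" for j
    using I that by (auto simp: bij_betw_def)
  have "\<exists>p. fst p < snd p \<and> fst p \<in> F \<and> snd p \<in> F \<and> I j = {fst p<..<snd p}" if "1 \<le> j" for j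
    using bounded_component_compl_eq_gap[OF compact_imp_closed[OF \<open>compact F\<close>] comp[OF that]]
    by (metis fst_conv snd_conv)
  then obtain p where p: "\<And>j. 1 \<le> j \<Longrightarrow>
      fst (p j) < snd (p j) \<and> fst (p j) \<in> F \<and> snd (p j) \<in> F \<and> I j = {fst (p j)<..<snd (p j)}"
    by metis
  define a b where "a = fst \<circ> p" and "b = snd \<circ> p"
  have ab: "a j < b j" "a j \<in> F" "b j \<in> F" "I j = {a j<..<b j}" if "1 \<le> j" for j
    using p[OF that] by (simp_all add: a_def b_def)
  have "gap_enumeration F a b"
  proof
    show "disjoint_family_on (\<lambda>j. {a j<..<b j}) {1..}"
      unfolding disjoint_family_on_def
    proof (intro ballI impI)
      fix i j :: nat assume ij: "i \<in> {1..}" "j \<in> {1..}" "i \<noteq> j"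
      then have "I i \<noteq> I j" using I by (auto simp: bij_betw_def inj_on_def)
      then have "I i \<inter> I j = {}"
        using components_nonoverlap[of "I i" "- F" "I j"] comp(1) ij by auto
      then show "{a i<..<b i} \<inter> {a j<..<b j} = {}" using ab(4) ij by auto
    qed
    have "F \<noteq> {}" using ab(2)[of 1] by auto
    then have ends: "Inf F \<in> F" "Sup F \<in> F"
      using \<open>compact F\<close>
      by (auto intro!: closed_contains_Inf closed_contains_Sup simp: compact_imp_closed
          bounded_imp_bdd_below bounded_imp_bdd_above compact_imp_bounded)
    show "{Inf F..Sup F} - F \<subseteq> (\<Union>j\<in>{1..}. {a j<..<b j})"
    proof
      fix z assume z: "z \<in> {Inf F..Sup F} - F"
      then obtain U where U: "U \<in> components (- F)" "z \<in> U"
        using Union_components[of "- F"] by blast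
      have "U \<subseteq> {Inf F..Sup F}"
      proof
        fix x assume "x \<in> U"
        have iv: "y \<in> U" if "x \<le> y \<and> y \<le> z \<or> z \<le> y \<and> y \<le> x" for y
          using in_components_connected[OF U(1)] U(2) \<open>x \<in> U\<close> that
          unfolding connected_iff_interval by blast
        have "Inf F \<notin> U" "Sup F \<notin> U" using in_components_subset[OF U(1)] ends by auto
        then show "x \<in> {Inf F..Sup F}" using iv[of "Inf F"] iv[of "Sup F"] z by force
      qed
      then have "bounded U" by (meson bounded_closed_interval bounded_subset)
      then obtain j where "j \<in> {1..}" "U = I j" using I U(1) by (auto simp: bij_betw_def)
      then show "z \<in> (\<Union>j\<in>{1..}. {a j<..<b j})" using U(2) ab(4) by auto
    qed
    show "{a j<..<b j} \<inter> F = {}" if "1 \<le> j" for j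
      using in_components_subset[OF comp(1)[OF that]] ab(4)[OF that] by auto
  qed (use ab \<open>compact F\<close> in auto)
  moreover have "l j = b j - a j" if "1 \<le> j" for j
    using l[OF that] ab[OF that] by simp
  ultimately show thesis using that by blast
qed

section \<open>Primitives of nonincreasing functions\<close>

text \<open>
  The common form of the two-sided bounds: on a filter, the function stays in a compact part of the
  positive half-line.
\<close>

definition positively_bounded :: "('a \<Rightarrow> real) \<Rightarrow> 'a filter \<Rightarrow> bool" where
  "positively_bounded f G \<longleftrightarrow> (\<exists>c>0. \<exists>C. \<forall>\<^sub>F x in G. c \<le> f x \<and> f x \<le> C)"

lemma positively_bounded_cong:
  assumes "\<forall>\<^sub>F x in G. f x = g x"
  shows "positively_bounded f G \<longleftrightarrow> positively_bounded g G"
proof -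
  have "(\<forall>\<^sub>F x in G. c \<le> f x \<and> f x \<le> C) \<longleftrightarrow> (\<forall>\<^sub>F x in G. c \<le> g x \<and> g x \<le> C)" for c C
    using assms by (intro eventually_subst) (auto elim: eventually_mono)
  then show ?thesis by (simp add: positively_bounded_def)
qed

lemma positively_bounded_scale_iff:
  assumes "0 < k"
  shows "positively_bounded (\<lambda>x. k * f x) G \<longleftrightarrow> positively_bounded f G"
proof -
  have scale: "positively_bounded (\<lambda>x. k * f x) G" if k: "0 < k" and f: "positively_bounded f G" for k f
  proof -
    obtain c C where "0 < c" and ev: "\<forall>\<^sub>F x in G. c \<le> f x \<and> f x \<le> C"
      using f unfolding positively_bounded_def by blast
    from ev have "\<forall>\<^sub>F x in G. k * c \<le> k * f x \<and> k * f x \<le> k * C"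
      using k by (auto elim: eventually_mono)
    then show ?thesis
      unfolding positively_bounded_def using k \<open>0 < c\<close> by (meson mult_pos_pos)
  qed
  show ?thesis
    using scale[of k f] scale[of "1 / k" "\<lambda>x. k * f x"] assms by auto
qed

lemma positively_bounded_filtermap:
  "positively_bounded f (filtermap g G) \<longleftrightarrow> positively_bounded (\<lambda>x. f (g x)) G"
  by (simp add: positively_bounded_def eventually_filtermap)

lemma times_at_right_0:
  fixes K :: real
  assumes "0 < K"
  shows "filterlim (\<lambda>x. K * x) (at_right 0) (at_right 0)"
  using filtermap_times_pos_at_right[OF assms, of 0] by (simp add: filterlim_def)

lemma powr_difference_quotient_tendsto:
  fixes p :: real
  shows "((\<lambda>K. (K powr p - 1) / (K - 1)) \<longlongrightarrow> p) (at 1 within S)"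
proof -
  have "((\<lambda>K. K powr p) has_real_derivative p * 1 powr (p - 1)) (at 1)"
    by (rule has_real_derivative_powr) simp
  then have "((\<lambda>K. (K powr p - 1) / (K - 1)) \<longlongrightarrow> p) (at 1)"
    by (simp add: has_field_derivative_iff)
  then show ?thesis by (rule tendsto_within_subset) simp
qed

text \<open>
  The constant \<open>B = A / (1 - q powr p)\<close> is the sum of the geometric series that arises from adding up
  the increments along \<open>x, q * x, q\<^sup>2 * x, \<dots>\<close>. Equivalently, \<open>g x = W x - B * x powr p\<close> does not
  decrease when \<open>x\<close> is replaced by \<open>q * x\<close>, and it tends to 0 along the sequence.
\<close>

lemma le_powr_of_scaling:
  fixes W :: "real \<Rightarrow> real"
  assumes "0 < q" "q < 1" "0 < p"
    and lim: "(W \<longlongrightarrow> 0) (at_right 0)"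
    and step: "\<And>x. 0 < x \<Longrightarrow> x < \<rho> \<Longrightarrow> W x - W (q * x) \<le> A * x powr p"
    and x: "0 < x" "x < \<rho>"
  shows "W x \<le> A / (1 - q powr p) * x powr p"
proof -
  define B where "B = A / (1 - q powr p)"
  define g where "g = (\<lambda>x. W x - B * x powr p)"
  have "q powr p < 1" using assms powr_less_mono2[of p q 1] by simp
  then have A: "A = B * (1 - q powr p)" by (simp add: B_def)
  have g_step: "g y \<le> g (q * y)" if "0 < y" "y < \<rho>" for y
    using step[OF that] that \<open>0 < q\<close> by (simp add: g_def A powr_mult algebra_simps)
  have g_iter: "g x \<le> g (q ^ n * x)" for n
  proof (induction n)
    case (Suc n)
    have "q ^ n * x \<le> 1 * x" using assms by (intro mult_right_mono power_le_one) auto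
    then have "q ^ n * x < \<rho>" using \<open>x < \<rho>\<close> by linarith
    then have "g (q ^ n * x) \<le> g (q * (q ^ n * x))" using assms by (intro g_step) auto
    with Suc show ?case by (simp add: mult.assoc)
  qed simp
  have "(\<lambda>n. q ^ n * x) \<longlonglongrightarrow> 0"
    using LIMSEQ_realpow_zero[of q] assms by (auto intro!: tendsto_mult_left_zero)
  then have lim_q: "filterlim (\<lambda>n. q ^ n * x) (at_right 0) sequentially"
    using assms by (intro tendsto_imp_filterlim_at_right) auto
  have lim_g: "(g \<longlongrightarrow> 0 - B * 0) (at_right 0)"
  proof -
    have "((\<lambda>x. x powr p) \<longlongrightarrow> 0) (at_right (0 :: real))"
      by (rule tendsto_zero_powrI[OF tendsto_ident_at tendsto_const])
        (auto simp: eventually_at_right_field \<open>0 < p\<close> intro: exI[of _ 1])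
    then show ?thesis unfolding g_def by (intro tendsto_intros lim)
  qed
  have "(\<lambda>n. g (q ^ n * x)) \<longlonglongrightarrow> 0"
    using filterlim_compose[OF lim_g lim_q] by simp
  then have "g x \<le> 0" by (rule LIMSEQ_le_const) (use g_iter in auto)
  then show ?thesis by (simp add: g_def B_def)
qed

text \<open>
  \<open>V\<close> is a primitive of a nonincreasing \<open>s\<close> on the positive half-line, expressed by bounds on
  increments. The exponent \<open>p\<close> is the growth rate against which \<open>V\<close> is measured,
  and \<open>p - 1\<close> the corresponding one for \<open>s\<close>.
\<close>

locale antitone_density =
  fixes V s :: "real \<Rightarrow> real" and p :: real
  assumes lower: "0 < r \<Longrightarrow> r < R \<Longrightarrow> (R - r) * s R \<le> V R - V r"
    and upper: "0 < r \<Longrightarrow> r < R \<Longrightarrow> V R - V r \<le> (R - r) * s r"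
    and vanish: "(V \<longlongrightarrow> 0) (at_right 0)"
    and pos: "0 < p"
begin

definition v :: "real \<Rightarrow> real" where "v r = V r / r powr p"

definition \<sigma> :: "real \<Rightarrow> real" where "\<sigma> r = s r / r powr (p - 1)"

lemma powr_diff_1: "0 < r \<Longrightarrow> r * r powr (p - 1) = r powr p" for r :: real
  using powr_add[of r 1 "p - 1"] by simp

text \<open>
  For every ratio \<open>q < 1\<close> the geometric partition gives a bound with a constant \<open>A q\<close>; as \<open>q\<close> tends to 1
  these constants tend to the sharp value \<open>C / p\<close> that integration of \<open>C * r powr (p - 1)\<close> suggests.
\<close>

lemma V_le:
  assumes s: "\<And>r. 0 < r \<Longrightarrow> r < \<rho> \<Longrightarrow> s r \<le> C * r powr (p - 1)" and "0 < r" "r < \<rho>"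
  shows "V r \<le> C / p * r powr p"
proof -
  define A where "A = (\<lambda>q. C * q powr (p - 1) / ((q powr p - 1) / (q - 1)))"
  have "V r \<le> A q * r powr p" if q: "0 < q" "q < 1" for q
  proof -
    have "V r \<le> (C * q powr (p - 1) * (1 - q)) / (1 - q powr p) * r powr p"
    proof (rule le_powr_of_scaling[OF q pos vanish])
      fix x assume x: "0 < x" "x < \<rho>"
      have "q * x < 1 * x" using q x by (intro mult_strict_right_mono) auto
      then have qx: "q * x < x" "q * x < \<rho>" using x by linarith+
      have "V x - V (q * x) \<le> (x - q * x) * s (q * x)"
        using q x qx by (intro upper) auto
      also have "\<dots> \<le> (x - q * x) * (C * (q * x) powr (p - 1))"
        using q x qx by (intro mult_left_mono s) auto
      also have "\<dots> = (C * q powr (p - 1) * (1 - q)) * (x * x powr (p - 1))"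
        using q x by (simp add: powr_mult algebra_simps)
      finally show "V x - V (q * x) \<le> (C * q powr (p - 1) * (1 - q)) * x powr p"
        using x by (simp add: powr_diff_1)
    qed fact+
    also have "(C * q powr (p - 1) * (1 - q)) / (1 - q powr p) = A q"
      using minus_divide_divide[of "C * q powr (p - 1) * (q - 1)" "q powr p - 1"]
      by (simp add: A_def algebra_simps)
    finally show ?thesis .
  qed
  then have "\<forall>\<^sub>F q in at_left 1. V r \<le> A q * r powr p"
    unfolding eventually_at_left_field by (intro exI[of _ 0]) simp
  moreover have "(A \<longlongrightarrow> C * 1 powr (p - 1) / p) (at_left 1)"
    unfolding A_def
    by (rule tendsto_divide[OF tendsto_mult_left[OF tendsto_powr[OF tendsto_ident_at tendsto_const]]
            powr_difference_quotient_tendsto]) (use pos in auto)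
  then have "(A \<longlongrightarrow> C / p) (at_left 1)" by simp
  then have "((\<lambda>q. A q * r powr p) \<longlongrightarrow> C / p * r powr p) (at_left 1)"
    by (rule tendsto_mult_right)
  ultimately show ?thesis
    by (intro tendsto_lowerbound) auto
qed

text \<open>
  The same argument for \<open>- V\<close>, with the increments estimated at their right ends.
\<close>

lemma V_ge:
  assumes s: "\<And>r. 0 < r \<Longrightarrow> r < \<rho> \<Longrightarrow> c * r powr (p - 1) \<le> s r" and "0 < r" "r < \<rho>"
  shows "c / p * r powr p \<le> V r"
proof -
  define A where "A = (\<lambda>q. c / ((q powr p - 1) / (q - 1)))"
  have "A q * r powr p \<le> V r" if q: "0 < q" "q < 1" for q
  proof -
    have "- V r \<le> (- c * (1 - q)) / (1 - q powr p) * r powr p"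
    proof (rule le_powr_of_scaling[OF q pos])
      show "((\<lambda>r. - V r) \<longlongrightarrow> 0) (at_right 0)"
        using tendsto_minus[OF vanish] by simp
      fix x assume x: "0 < x" "x < \<rho>"
      have "q * x < 1 * x" using q x by (intro mult_strict_right_mono) auto
      then have qx: "q * x < x" "q * x < \<rho>" using x by linarith+
      have "c * (1 - q) * (x * x powr (p - 1)) = (x - q * x) * (c * x powr (p - 1))"
        by (simp add: algebra_simps)
      also have "\<dots> \<le> (x - q * x) * s x"
        using q x qx by (intro mult_left_mono s) auto
      also have "\<dots> \<le> V x - V (q * x)"
        using q x qx by (intro lower) auto
      finally show "- V x - - V (q * x) \<le> (- c * (1 - q)) * x powr p"
        using x by (simp add: powr_diff_1)
    qed fact+
    also have "(- c * (1 - q)) / (1 - q powr p) = - A q"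
      using minus_divide_right[of "c * (q - 1)" "q powr p - 1"]
      by (simp add: A_def algebra_simps)
    finally show ?thesis by simp
  qed
  then have "\<forall>\<^sub>F q in at_left 1. A q * r powr p \<le> V r"
    unfolding eventually_at_left_field by (intro exI[of _ 0]) simp
  moreover have "(A \<longlongrightarrow> c / p) (at_left 1)"
    unfolding A_def
    by (rule tendsto_divide[OF _ powr_difference_quotient_tendsto])
      (use pos in \<open>auto intro!: tendsto_intros\<close>)
  then have "((\<lambda>q. A q * r powr p) \<longlongrightarrow> c / p * r powr p) (at_left 1)"
    by (rule tendsto_mult_right)
  ultimately show ?thesis
    by (intro tendsto_upperbound) auto
qed

lemma eventually_v_le:
  assumes "\<forall>\<^sub>F r in at_right 0. \<sigma> r \<le> C"
  shows "\<forall>\<^sub>F r in at_right 0. v r \<le> C / p"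
proof -
  obtain \<rho> where "0 < \<rho>" and \<rho>: "\<And>r. 0 < r \<Longrightarrow> r < \<rho> \<Longrightarrow> \<sigma> r \<le> C"
    using assms unfolding eventually_at_right_field by auto
  have "V r \<le> C / p * r powr p" if "0 < r" "r < \<rho>" for r
    using V_le[OF _ that, of C] \<rho> by (simp add: \<sigma>_def pos_divide_le_eq)
  then have "v r \<le> C / p" if "0 < r" "r < \<rho>" for r
    using that by (simp add: v_def pos_divide_le_eq)
  then show ?thesis unfolding eventually_at_right_field using \<open>0 < \<rho>\<close> by auto
qed

lemma eventually_v_ge:
  assumes "\<forall>\<^sub>F r in at_right 0. c \<le> \<sigma> r"
  shows "\<forall>\<^sub>F r in at_right 0. c / p \<le> v r"
proof -
  obtain \<rho> where "0 < \<rho>" and \<rho>: "\<And>r. 0 < r \<Longrightarrow> r < \<rho> \<Longrightarrow> c \<le> \<sigma> r"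
    using assms unfolding eventually_at_right_field by auto
  have "c / p * r powr p \<le> V r" if "0 < r" "r < \<rho>" for r
    using V_ge[OF _ that, of c] \<rho> by (simp add: \<sigma>_def pos_le_divide_eq)
  then have "c / p \<le> v r" if "0 < r" "r < \<rho>" for r
    using that by (simp add: v_def pos_le_divide_eq)
  then show ?thesis unfolding eventually_at_right_field using \<open>0 < \<rho>\<close> by auto
qed

text \<open>
  Division of the difference quotient of \<open>V\<close> between \<open>r\<close> and \<open>K * r\<close> by \<open>r powr (p - 1)\<close> makes it an
  expression in the normalized function \<open>v\<close> alone. For \<open>v\<close> constant, its value tends to \<open>p * v\<close> as
  \<open>K\<close> tends to 1.
\<close>

lemma difference_quotient_eq:
  assumes "0 < r" "0 < K"
  shows "(V (K * r) - V r) / ((K - 1) * r) / r powr (p - 1) = (K powr p * v (K * r) - v r) / (K - 1)"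
proof -
  have "(V (K * r) - V r) / ((K - 1) * r) / r powr (p - 1)
      = (V (K * r) - V r) / ((K - 1) * (r * r powr (p - 1)))"
    by (simp add: mult.assoc)
  also have "\<dots> = (K powr p * v (K * r) - v r) / (K - 1)"
    using assms by (simp add: powr_diff_1 v_def powr_mult diff_divide_distrib mult.commute)
  finally show ?thesis .
qed

lemma \<sigma>_ge:
  assumes "0 < r" "1 < K"
  shows "(K powr p * v (K * r) - v r) / (K - 1) \<le> \<sigma> r"
proof -
  have "V (K * r) - V r \<le> (K * r - r) * s r" using assms by (intro upper) auto
  then have "(V (K * r) - V r) / ((K - 1) * r) \<le> s r"
    using assms by (simp add: pos_divide_le_eq algebra_simps)
  then have "(V (K * r) - V r) / ((K - 1) * r) / r powr (p - 1) \<le> \<sigma> r"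
    unfolding \<sigma>_def by (rule divide_right_mono) simp
  then show ?thesis using assms by (subst (asm) difference_quotient_eq) auto
qed

lemma \<sigma>_le:
  assumes "0 < r" "0 < K" "K < 1"
  shows "\<sigma> r \<le> (K powr p * v (K * r) - v r) / (K - 1)"
proof -
  have "(r - K * r) * s r \<le> V r - V (K * r)" using assms by (intro lower) auto
  then have "s r \<le> (V r - V (K * r)) / ((1 - K) * r)"
    using assms by (simp add: pos_le_divide_eq algebra_simps)
  also have "\<dots> = (V (K * r) - V r) / ((K - 1) * r)"
    using minus_divide_divide[of "V (K * r) - V r" "(K - 1) * r"] by (simp add: algebra_simps)
  finally have "\<sigma> r \<le> (V (K * r) - V r) / ((K - 1) * r) / r powr (p - 1)"
    unfolding \<sigma>_def by (rule divide_right_mono) simp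
  then show ?thesis using assms by (subst (asm) difference_quotient_eq) auto
qed

lemma eventually_scaled:
  assumes "0 < K" "eventually P (at_right (0::real))"
  shows "\<forall>\<^sub>F r in at_right 0. P (K * r)"
  using filterlim_iff[THEN iffD1, OF times_at_right_0[OF assms(1)]] assms(2) by blast

text \<open>
  If \<open>c \<le> v \<le> C\<close>, the lower bound from \<open>\<sigma>_ge\<close> is positive as soon as \<open>K powr p * c > C\<close>: then \<open>V\<close> must
  have grown between \<open>r\<close> and \<open>K * r\<close>. For the upper bound any ratio below 1 serves; here it is \<open>1 / 2\<close>.
\<close>

theorem positively_bounded_iff:
  "positively_bounded v (at_right 0) \<longleftrightarrow> positively_bounded \<sigma> (at_right 0)"
proof
  assume "positively_bounded \<sigma> (at_right 0)"
  then obtain c C where "0 < c" and ev: "\<forall>\<^sub>F r in at_right 0. c \<le> \<sigma> r" "\<forall>\<^sub>F r in at_right 0. \<sigma> r \<le> C"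
    by (auto simp: positively_bounded_def eventually_conj_iff)
  then have "\<forall>\<^sub>F r in at_right 0. c / p \<le> v r \<and> v r \<le> C / p"
    using eventually_v_le eventually_v_ge by (simp add: eventually_conj_iff)
  then show "positively_bounded v (at_right 0)"
    unfolding positively_bounded_def using \<open>0 < c\<close> pos by (meson divide_pos_pos)
next
  assume "positively_bounded v (at_right 0)"
  then obtain c C where "0 < c" and ev: "\<forall>\<^sub>F r in at_right 0. c \<le> v r \<and> v r \<le> C"
    by (auto simp: positively_bounded_def)
  \<comment> \<open>Chosen so that \<open>K powr p * c = \<bar>C\<bar> + 2 * c > C\<close>.\<close>
  define K where "K = (\<bar>C\<bar> / c + 2) powr (1 / p)"
  have K: "K powr p = \<bar>C\<bar> / c + 2" "1 < K"
  proof -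
    have "0 \<le> \<bar>C\<bar> / c" using \<open>0 < c\<close> by simp
    then show "K powr p = \<bar>C\<bar> / c + 2" "1 < K"
      using pos gr_one_powr[of "\<bar>C\<bar> / c + 2" "1 / p"] by (simp_all add: K_def powr_powr)
  qed
  have "C < K powr p * c" using \<open>0 < c\<close> by (simp add: K distrib_right)
  define c' where "c' = (K powr p * c - C) / (K - 1)"
  have "0 < c'" using K \<open>C < K powr p * c\<close> by (simp add: c'_def)
  have "\<forall>\<^sub>F r in at_right 0. c \<le> v (K * r) \<and> v (K * r) \<le> C"
    using K eventually_scaled[of K, OF _ ev] by simp
  with ev have lo: "\<forall>\<^sub>F r in at_right 0. c' \<le> \<sigma> r"
    using eventually_at_right_less[of 0]
  proof eventually_elim
    case (elim r)
    have "c' \<le> (K powr p * v (K * r) - v r) / (K - 1)"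
      unfolding c'_def using elim K(2) by (intro divide_right_mono diff_mono mult_left_mono) auto
    also have "\<dots> \<le> \<sigma> r" using elim K by (intro \<sigma>_ge) auto
    finally show ?case .
  qed
  have "\<forall>\<^sub>F r in at_right 0. c \<le> v (1 / 2 * r) \<and> v (1 / 2 * r) \<le> C"
    using eventually_scaled[of "1 / 2", OF _ ev] by simp
  with ev have up: "\<forall>\<^sub>F r in at_right 0. \<sigma> r \<le> 2 * C"
    using eventually_at_right_less[of 0]
  proof eventually_elim
    case (elim r)
    have "\<sigma> r \<le> ((1 / 2) powr p * v (1 / 2 * r) - v r) / (1 / 2 - 1)"
      using elim by (intro \<sigma>_le) auto
    also have "\<dots> = 2 * v r - 2 * ((1 / 2) powr p * v (1 / 2 * r))" by simp
    also have "\<dots> \<le> 2 * C"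
    proof -
      have "0 \<le> (1 / 2) powr p * v (1 / 2 * r)" using elim \<open>0 < c\<close> by (intro mult_nonneg_nonneg) auto
      then show ?thesis using elim by linarith
    qed
    finally show ?case .
  qed
  from lo up show "positively_bounded \<sigma> (at_right 0)"
    unfolding positively_bounded_def using \<open>0 < c'\<close> by (metis (mono_tags) eventually_conj_iff)
qed

text \<open>
  The harder direction is the monotone density theorem for a power: the difference quotients with
  ratio \<open>K\<close> bound \<open>\<sigma>\<close> from below for \<open>K > 1\<close> and from above for \<open>K < 1\<close>, and their limits
  \<open>(K powr p - 1) / (K - 1) * m\<close> are arbitrarily close to \<open>p * m\<close>.
\<close>

theorem tendsto_iff:
  "(v \<longlongrightarrow> m) (at_right 0) \<longleftrightarrow> (\<sigma> \<longlongrightarrow> p * m) (at_right 0)"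
proof
  assume \<sigma>: "(\<sigma> \<longlongrightarrow> p * m) (at_right 0)"
  show "(v \<longlongrightarrow> m) (at_right 0)"
  proof (rule order_tendstoI)
    fix y assume "y < m"
    then obtain z where z: "y < z" "z < m" using dense by blast
    have "\<forall>\<^sub>F r in at_right 0. p * z < \<sigma> r"
      using z pos by (intro order_tendstoD(1)[OF \<sigma>]) auto
    then have "\<forall>\<^sub>F r in at_right 0. p * z / p \<le> v r"
      by (intro eventually_v_ge) (auto elim: eventually_mono)
    then show "\<forall>\<^sub>F r in at_right 0. y < v r"
      using z pos by (auto elim!: eventually_mono)
  next
    fix y assume "m < y"
    then obtain z where z: "m < z" "z < y" using dense by blast
    have "\<forall>\<^sub>F r in at_right 0. \<sigma> r < p * z"
      using z pos by (intro order_tendstoD(2)[OF \<sigma>]) auto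
    then have "\<forall>\<^sub>F r in at_right 0. v r \<le> p * z / p"
      by (intro eventually_v_le) (auto elim: eventually_mono)
    then show "\<forall>\<^sub>F r in at_right 0. v r < y"
      using z pos by (auto elim!: eventually_mono)
  qed
next
  assume v: "(v \<longlongrightarrow> m) (at_right 0)"
  define \<phi> where "\<phi> = (\<lambda>K r. (K powr p * v (K * r) - v r) / (K - 1))"
  have \<phi>: "(\<phi> K \<longlongrightarrow> (K powr p - 1) / (K - 1) * m) (at_right 0)" if "0 < K" "K \<noteq> 1" for K
  proof -
    have "((\<lambda>r. v (K * r)) \<longlongrightarrow> m) (at_right 0)"
      using v times_at_right_0[OF that(1)] by (rule filterlim_compose)
    then have "(\<phi> K \<longlongrightarrow> (K powr p * m - m) / (K - 1)) (at_right 0)"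
      unfolding \<phi>_def using v that by (intro tendsto_intros) auto
    then show ?thesis by (simp add: algebra_simps)
  qed
  have quot: "((\<lambda>K. (K powr p - 1) / (K - 1) * m) \<longlongrightarrow> p * m) (at 1 within S)" for S
    by (rule tendsto_mult_right[OF powr_difference_quotient_tendsto])
  show "(\<sigma> \<longlongrightarrow> p * m) (at_right 0)"
  proof (rule order_tendstoI)
    fix y assume "y < p * m"
    then have "\<forall>\<^sub>F K in at_right 1. y < (K powr p - 1) / (K - 1) * m"
      using order_tendstoD(1)[OF quot] by blast
    moreover have "\<forall>\<^sub>F K in at_right 1. (1::real) < K" by (rule eventually_at_right_less)
    ultimately obtain K where K: "1 < K" "y < (K powr p - 1) / (K - 1) * m"
      using eventually_happens'[OF trivial_limit_at_right_real eventually_conj] by blast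
    then have "\<forall>\<^sub>F r in at_right 0. y < \<phi> K r"
      by (intro order_tendstoD(1)[OF \<phi>]) auto
    then show "\<forall>\<^sub>F r in at_right 0. y < \<sigma> r"
      using eventually_at_right_less[of 0]
    proof eventually_elim
      case (elim r)
      then show ?case using \<sigma>_ge[of r K] K by (simp add: \<phi>_def)
    qed
  next
    fix y assume "p * m < y"
    then have "\<forall>\<^sub>F K in at_left 1. (K powr p - 1) / (K - 1) * m < y"
      using order_tendstoD(2)[OF quot] by blast
    moreover have "\<forall>\<^sub>F K in at_left 1. (0::real) < K \<and> K < 1"
      by (auto simp: eventually_at_left_field intro: exI[of _ 0])
    ultimately obtain K where K: "0 < K" "K < 1" "(K powr p - 1) / (K - 1) * m < y"
      using eventually_happens'[OF trivial_limit_at_left_real eventually_conj] by blast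
    then have "\<forall>\<^sub>F r in at_right 0. \<phi> K r < y"
      by (intro order_tendstoD(2)[OF \<phi>]) auto
    then show "\<forall>\<^sub>F r in at_right 0. \<sigma> r < y"
      using eventually_at_right_less[of 0]
    proof eventually_elim
      case (elim r)
      then show ?case using \<sigma>_le[of r K] K by (simp add: \<phi>_def)
    qed
  qed
qed

end

section \<open>Counting functions of nonincreasing sequences\<close>

text \<open>
  Finiteness of the superlevel sets, together with monotonicity, expresses that \<open>l\<close> tends to 0; it
  is stated in this form because the cardinalities of these sets are the counting function.
\<close>

locale length_sequence =
  fixes l :: "nat \<Rightarrow> real" and D :: real
  assumes positive: "1 \<le> j \<Longrightarrow> 0 < l j"
    and antitone: "1 \<le> i \<Longrightarrow> i \<le> j \<Longrightarrow> l j \<le> l i"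
    and finite_above: "0 < x \<Longrightarrow> finite {j. 1 \<le> j \<and> x < l j}"
    and D_pos: "0 < D"
begin

definition N :: "real \<Rightarrow> nat" where "N x = card {j. 1 \<le> j \<and> x < l j}"

text \<open>
  The summand 1 belongs to the two extreme boundary points of a parallel set, so that the number of
  boundary points at radius \<open>r\<close> is \<open>2 * (1 + N (2 * r))\<close>. It also gives \<open>\<mu> (N x + 1) \<le> \<nu> x\<close>.
\<close>

definition \<nu> :: "real \<Rightarrow> real" where "\<nu> x = (1 + real (N x)) * x powr D"

definition \<mu> :: "nat \<Rightarrow> real" where "\<mu> j = real j * l j powr D"

text \<open>
  The indices of terms larger than \<open>x\<close> form an initial segment, so \<open>N\<close> is a generalized inverse of \<open>l\<close>.
\<close>

lemma less_length_iff:
  assumes "0 < x" "1 \<le> j"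
  shows "x < l j \<longleftrightarrow> j \<le> N x"
proof -
  define S where "S = {j. 1 \<le> j \<and> x < l j}"
  have "finite S" unfolding S_def by (rule finite_above[OF assms(1)])
  show ?thesis
  proof
    assume "x < l j"
    have "{1..j} \<subseteq> S"
    proof
      fix i assume "i \<in> {1..j}"
      then have "l j \<le> l i" "1 \<le> i" using antitone[of i j] by auto
      then show "i \<in> S" using \<open>x < l j\<close> by (simp add: S_def)
    qed
    then show "j \<le> N x"
      using card_mono[OF \<open>finite S\<close>, of "{1..j}"] by (simp add: N_def S_def)
  next
    assume "j \<le> N x"
    show "x < l j"
    proof (rule ccontr)
      assume "\<not> x < l j"
      have "S \<subseteq> {1..<j}"
      proof
        fix i assume i: "i \<in> S"
        then have "\<not> j \<le> i" using antitone[of j i] assms(2) \<open>\<not> x < l j\<close> by (auto simp: S_def)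
        then show "i \<in> {1..<j}" using i by (simp add: S_def)
      qed
      then have "card S \<le> j - 1" using card_mono[of "{1..<j}" S] by simp
      then show False using \<open>j \<le> N x\<close> assms(2) by (simp add: N_def S_def)
    qed
  qed
qed

lemma \<mu>_le_\<nu>:
  assumes "0 < x"
  shows "\<mu> (N x + 1) \<le> \<nu> x"
proof -
  have "l (N x + 1) \<le> x" using less_length_iff[OF assms, of "N x + 1"] by simp
  then have "l (N x + 1) powr D \<le> x powr D"
    using positive[of "N x + 1"] D_pos by (intro powr_mono2) auto
  then show ?thesis by (simp add: \<mu>_def \<nu>_def mult_left_mono)
qed

lemma \<nu>_le_\<mu>:
  assumes "0 < x" "1 \<le> N x"
  shows "\<nu> x \<le> \<mu> (N x) + x powr D"
proof -
  have "x < l (N x)" using less_length_iff[OF assms] by simp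
  then have "x powr D \<le> l (N x) powr D" using assms D_pos by (intro powr_mono2) auto
  then have "real (N x) * x powr D \<le> \<mu> (N x)" unfolding \<mu>_def by (rule mult_left_mono) simp
  then show ?thesis by (simp add: \<nu>_def distrib_right)
qed

lemma \<nu>_length_le:
  assumes "1 \<le> j"
  shows "\<nu> (l j) \<le> \<mu> j"
proof -
  have "\<not> j \<le> N (l j)" using less_length_iff[OF positive[OF assms] assms] by simp
  then show ?thesis unfolding \<nu>_def \<mu>_def by (intro mult_right_mono) auto
qed

text \<open>
  The counting function jumps at \<open>l j\<close>, where it has not yet counted \<open>j\<close>; the factor \<open>\<theta> < 1\<close> moves the
  argument to the side of the jump where \<open>j\<close> is counted.
\<close>

lemma \<mu>_le_\<nu>_scaled:
  assumes "1 \<le> j" "0 < \<theta>" "\<theta> < 1"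
  shows "\<theta> powr D * \<mu> j \<le> \<nu> (\<theta> * l j)"
proof -
  have "\<theta> * l j < l j" using positive[OF assms(1)] assms by simp
  then have "j \<le> N (\<theta> * l j)"
    using less_length_iff[of "\<theta> * l j" j] positive[OF assms(1)] assms by simp
  then have "real j * (\<theta> * l j) powr D \<le> (1 + real (N (\<theta> * l j))) * (\<theta> * l j) powr D"
    by (intro mult_right_mono) auto
  then show ?thesis
    using positive[OF assms(1)] assms by (simp add: \<nu>_def \<mu>_def powr_mult mult_ac)
qed

lemma length_at_right_0: "filterlim l (at_right 0) sequentially"
proof (rule tendsto_imp_filterlim_at_right)
  have "\<forall>\<^sub>F j in sequentially. \<bar>l j - 0\<bar> < e" if "0 < e" for e
    using eventually_gt_at_top[of "N (e / 2)"]
  proof eventually_elim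
    case (elim j)
    then have "l j \<le> e / 2" "0 < l j"
      using less_length_iff[of "e / 2" j] positive[of j] that by auto
    then show ?case using that by simp
  qed
  then show "l \<longlonglongrightarrow> 0" by (simp add: tendsto_iff dist_real_def)
  show "\<forall>\<^sub>F j in sequentially. 0 < l j"
    using eventually_ge_at_top[of 1] by eventually_elim (rule positive)
qed

lemma N_at_top: "filterlim N at_top (at_right 0)"
  unfolding filterlim_at_top
proof
  fix n
  have "n \<le> N x" if "0 < x" "x < l (n + 1)" for x
    using less_length_iff[of x "n + 1"] that by simp
  then show "\<forall>\<^sub>F x in at_right 0. n \<le> N x"
    unfolding eventually_at_right_field using positive[of "n + 1"] by auto
qed

lemma powr_D_tendsto_0: "((\<lambda>x. x powr D) \<longlongrightarrow> 0) (at_right 0)"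
  by (rule tendsto_zero_powrI[OF tendsto_ident_at tendsto_const])
    (auto simp: eventually_at_right_field D_pos intro: exI[of _ 1])

lemma eventually_\<nu>_squeezed:
  "\<forall>\<^sub>F x in at_right 0. \<mu> (N x + 1) \<le> \<nu> x \<and> \<nu> x \<le> \<mu> (N x) + x powr D"
  using eventually_at_right_less[of 0] filterlim_at_top[THEN iffD1, OF N_at_top, rule_format, of 1]
proof eventually_elim
  case (elim x)
  then show ?case by (intro conjI \<mu>_le_\<nu> \<nu>_le_\<mu>)
qed

theorem positively_bounded_iff:
  "positively_bounded \<nu> (at_right 0) \<longleftrightarrow> positively_bounded \<mu> sequentially"
proof
  assume "positively_bounded \<nu> (at_right 0)"
  then obtain c C where "0 < c" and ev: "\<forall>\<^sub>F x in at_right 0. c \<le> \<nu> x \<and> \<nu> x \<le> C"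
    unfolding positively_bounded_def by blast
  have half: "filterlim (\<lambda>j. 1 / 2 * l j) (at_right 0) sequentially"
    by (rule filterlim_compose[OF times_at_right_0 length_at_right_0]) simp
  have "\<forall>\<^sub>F j in sequentially. c \<le> \<mu> j \<and> \<mu> j \<le> 2 powr D * C"
    using eventually_ge_at_top[of 1]
      filterlim_iff[THEN iffD1, OF length_at_right_0, rule_format, OF ev]
      filterlim_iff[THEN iffD1, OF half, rule_format, OF ev]
  proof eventually_elim
    case (elim j)
    have "(1 / 2) powr D * \<mu> j \<le> C"
      using \<mu>_le_\<nu>_scaled[OF elim(1), of "1 / 2"] elim by linarith
    then have "\<mu> j \<le> 2 powr D * C"
      by (simp add: powr_divide pos_divide_le_eq mult.commute)
    then show ?case using \<nu>_length_le[OF elim(1)] elim by linarith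
  qed
  then show "positively_bounded \<mu> sequentially"
    unfolding positively_bounded_def using \<open>0 < c\<close> by blast
next
  assume "positively_bounded \<mu> sequentially"
  then obtain c C where "0 < c" and ev: "\<forall>\<^sub>F j in sequentially. c \<le> \<mu> j \<and> \<mu> j \<le> C"
    unfolding positively_bounded_def by blast
  have ev1: "\<forall>\<^sub>F j in sequentially. c \<le> \<mu> (j + 1) \<and> \<mu> (j + 1) \<le> C"
    using ev eventually_sequentially_seg[of "\<lambda>j. c \<le> \<mu> j \<and> \<mu> j \<le> C" 1] by simp
  have "\<forall>\<^sub>F x in at_right 0. x powr D < 1"
    by (rule order_tendstoD(2)[OF powr_D_tendsto_0]) simp
  then have "\<forall>\<^sub>F x in at_right 0. c \<le> \<nu> x \<and> \<nu> x \<le> C + 1"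
    using eventually_\<nu>_squeezed
      filterlim_iff[THEN iffD1, OF N_at_top, rule_format, OF ev]
      filterlim_iff[THEN iffD1, OF N_at_top, rule_format, OF ev1]
    by eventually_elim auto
  then show "positively_bounded \<nu> (at_right 0)"
    unfolding positively_bounded_def using \<open>0 < c\<close> by blast
qed

text \<open>
  A limit of \<open>\<nu>\<close> passes to \<open>\<mu>\<close> because the values of \<open>\<nu>\<close> at \<open>l j\<close> and at \<open>\<theta> * l j\<close> enclose
  \<open>\<mu> j\<close> up to a factor \<open>\<theta> powr D\<close>, which may be taken close to 1. Conversely, up to a summand that
  tends to 0, \<open>\<nu>\<close> is squeezed between values of \<open>\<mu>\<close> at indices that tend to infinity.
\<close>

theorem tendsto_iff:
  "(\<nu> \<longlongrightarrow> A) (at_right 0) \<longleftrightarrow> \<mu> \<longlonglongrightarrow> A"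
proof
  assume \<nu>: "(\<nu> \<longlongrightarrow> A) (at_right 0)"
  show "\<mu> \<longlonglongrightarrow> A"
  proof (rule order_tendstoI)
    fix y assume "y < A"
    have "\<forall>\<^sub>F j in sequentially. y < \<nu> (l j)"
      using filterlim_iff[THEN iffD1, OF length_at_right_0] order_tendstoD(1)[OF \<nu> \<open>y < A\<close>]
      by blast
    then show "\<forall>\<^sub>F j in sequentially. y < \<mu> j"
      using eventually_ge_at_top[of 1]
      by eventually_elim (use \<nu>_length_le in force)
  next
    fix y assume "A < y"
    have "((\<lambda>\<theta>. \<theta> powr D * y) \<longlongrightarrow> 1 powr D * y) (at_left 1)"
      by (intro tendsto_intros) auto
    then have "\<forall>\<^sub>F \<theta> in at_left 1. A < \<theta> powr D * y"
      using order_tendstoD(1)[of _ "1 powr D * y"] \<open>A < y\<close> by simp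
    moreover have "\<forall>\<^sub>F \<theta> in at_left 1. (0::real) < \<theta> \<and> \<theta> < 1"
      by (auto simp: eventually_at_left_field intro: exI[of _ 0])
    ultimately obtain \<theta> where \<theta>: "A < \<theta> powr D * y" "0 < \<theta>" "\<theta> < 1"
      using eventually_happens'[OF trivial_limit_at_left_real eventually_conj] by blast
    have "filterlim (\<lambda>j. \<theta> * l j) (at_right 0) sequentially"
      by (rule filterlim_compose[OF times_at_right_0[OF \<theta>(2)] length_at_right_0])
    then have "\<forall>\<^sub>F j in sequentially. \<nu> (\<theta> * l j) < \<theta> powr D * y"
      using order_tendstoD(2)[OF \<nu> \<theta>(1)] unfolding filterlim_iff by blast
    then show "\<forall>\<^sub>F j in sequentially. \<mu> j < y"
      using eventually_ge_at_top[of 1]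
    proof eventually_elim
      case (elim j)
      then have "\<theta> powr D * \<mu> j < \<theta> powr D * y"
        using \<mu>_le_\<nu>_scaled[OF _ \<theta>(2,3), of j] by linarith
      then show ?case using \<theta> by simp
    qed
  qed
next
  assume \<mu>: "\<mu> \<longlonglongrightarrow> A"
  have lower: "((\<lambda>x. \<mu> (N x + 1)) \<longlongrightarrow> A) (at_right 0)"
    using filterlim_compose[OF LIMSEQ_ignore_initial_segment[OF \<mu>, of 1] N_at_top] by simp
  have "((\<lambda>x. \<mu> (N x) + x powr D) \<longlongrightarrow> A + 0) (at_right 0)"
    by (intro tendsto_add powr_D_tendsto_0 filterlim_compose[OF \<mu> N_at_top])
  then have upper: "((\<lambda>x. \<mu> (N x) + x powr D) \<longlongrightarrow> A) (at_right 0)" by simp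
  show "(\<nu> \<longlongrightarrow> A) (at_right 0)"
    using eventually_\<nu>_squeezed unfolding eventually_conj_iff
    by (intro real_tendsto_sandwich[OF _ _ lower upper]) blast+
qed

text \<open>
  Both directions are recorded, because bounds and limits are carried over by composition with a power.
\<close>

lemma ratio_eq:
  assumes "1 \<le> j"
  shows "l j / real j powr (- 1 / D) = \<mu> j powr (1 / D)"
    and "\<mu> j = (l j / real j powr (- 1 / D)) powr D"
proof -
  have "l j / real j powr (- 1 / D) = real j powr (1 / D) * l j"
    using assms by (simp add: powr_minus_divide)
  moreover have "\<mu> j powr (1 / D) = real j powr (1 / D) * l j"
    using assms positive[OF assms] D_pos by (simp add: \<mu>_def powr_mult powr_powr)
  ultimately show eq: "l j / real j powr (- 1 / D) = \<mu> j powr (1 / D)" by simp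
  have "0 < \<mu> j" using assms positive[OF assms] by (simp add: \<mu>_def)
  then show "\<mu> j = (l j / real j powr (- 1 / D)) powr D"
    unfolding eq using D_pos by (simp add: powr_powr)
qed

lemma eventually_ratio_eq:
  "\<forall>\<^sub>F j in sequentially. l j / real j powr (- 1 / D) = \<mu> j powr (1 / D)"
  "\<forall>\<^sub>F j in sequentially. \<mu> j = (l j / real j powr (- 1 / D)) powr D"
  by (rule eventually_sequentiallyI[of 1], rule ratio_eq, assumption)+

lemma asymp_comparable_iff:
  "asymp_comparable l (\<lambda>j. real j powr (- 1 / D)) \<longleftrightarrow> positively_bounded \<mu> sequentially"
proof -
  have powr: "positively_bounded (\<lambda>j. f j powr t) sequentially"
    if f: "positively_bounded f sequentially" and "0 < t" for f :: "nat \<Rightarrow> real" and t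
  proof -
    obtain c C where "0 < c" and ev: "\<forall>\<^sub>F j in sequentially. c \<le> f j \<and> f j \<le> C"
      using f unfolding positively_bounded_def by blast
    from ev have "\<forall>\<^sub>F j in sequentially. c powr t \<le> f j powr t \<and> f j powr t \<le> C powr t"
      by eventually_elim (use \<open>0 < c\<close> \<open>0 < t\<close> in \<open>auto intro!: powr_mono2\<close>)
    moreover have "0 < c powr t" using \<open>0 < c\<close> by simp
    ultimately show ?thesis unfolding positively_bounded_def by blast
  qed
  have "asymp_comparable l (\<lambda>j. real j powr (- 1 / D))
      \<longleftrightarrow> positively_bounded (\<lambda>j. l j / real j powr (- 1 / D)) sequentially"
  proof
    assume "asymp_comparable l (\<lambda>j. real j powr (- 1 / D))"
    then show "positively_bounded (\<lambda>j. l j / real j powr (- 1 / D)) sequentially"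
      unfolding asymp_comparable_def positively_bounded_def eventually_sequentially by blast
  next
    assume "positively_bounded (\<lambda>j. l j / real j powr (- 1 / D)) sequentially"
    then obtain c C j0 where "0 < c"
      and b: "\<And>j. j0 \<le> j \<Longrightarrow> c \<le> l j / real j powr (- 1 / D) \<and> l j / real j powr (- 1 / D) \<le> C"
      unfolding positively_bounded_def eventually_sequentially by blast
    moreover have "0 < C" using b[of j0] \<open>0 < c\<close> by linarith
    ultimately show "asymp_comparable l (\<lambda>j. real j powr (- 1 / D))"
      unfolding asymp_comparable_def by blast
  qed
  also have "\<dots> \<longleftrightarrow> positively_bounded \<mu> sequentially"
    using powr[of "\<lambda>j. l j / real j powr (- 1 / D)" D] powr[of \<mu> "1 / D"] D_pos
      positively_bounded_cong[OF eventually_ratio_eq(1)]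
      positively_bounded_cong[OF eventually_ratio_eq(2)] by auto
  finally show ?thesis .
qed

lemma asymp_equiv_iff:
  assumes "0 < L"
  shows "l \<sim>[at_top] (\<lambda>j. L * real j powr (- 1 / D)) \<longleftrightarrow> \<mu> \<longlonglongrightarrow> L powr D"
proof -
  define \<rho> where "\<rho> = (\<lambda>j. l j / real j powr (- 1 / D))"
  have "l \<sim>[at_top] (\<lambda>j. L * real j powr (- 1 / D)) \<longleftrightarrow> (\<lambda>j. \<rho> j / L) \<longlonglongrightarrow> 1"
  proof -
    have "\<forall>\<^sub>F j in sequentially. (if l j = 0 \<and> L * real j powr (- 1 / D) = 0 then 1
        else l j / (L * real j powr (- 1 / D))) = \<rho> j / L"
      using eventually_ge_at_top[of 1]
    proof eventually_elim
      case (elim j)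
      then show ?case using positive[of j] by (simp add: \<rho>_def mult.commute)
    qed
    then show ?thesis unfolding asymp_equiv_def by (rule tendsto_cong)
  qed
  also have "\<dots> \<longleftrightarrow> \<rho> \<longlonglongrightarrow> L"
    using tendsto_mult_left[of "\<lambda>j. \<rho> j / L" 1 sequentially L]
      tendsto_divide[of \<rho> L sequentially "\<lambda>_. L" L] assms by auto
  also have "\<dots> \<longleftrightarrow> \<mu> \<longlonglongrightarrow> L powr D"
  proof
    assume "\<rho> \<longlonglongrightarrow> L"
    then have "(\<lambda>j. \<rho> j powr D) \<longlonglongrightarrow> L powr D"
      using assms by (intro tendsto_powr tendsto_const) auto
    then show "\<mu> \<longlonglongrightarrow> L powr D"
      using tendsto_cong[OF eventually_ratio_eq(2)] by (simp add: \<rho>_def)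
  next
    assume "\<mu> \<longlonglongrightarrow> L powr D"
    then have "(\<lambda>j. \<mu> j powr (1 / D)) \<longlonglongrightarrow> (L powr D) powr (1 / D)"
      using assms by (intro tendsto_powr tendsto_const) auto
    then show "\<rho> \<longlonglongrightarrow> L"
      using tendsto_cong[OF eventually_ratio_eq(1)] assms D_pos by (simp add: \<rho>_def powr_powr)
  qed
  finally show ?thesis .
qed

end

section \<open>Lower and upper limits of normalized functions\<close>

lemma Liminf_Limsup_ennreal_bounds:
  fixes f :: "'a \<Rightarrow> real"
  assumes "0 < k" "G \<noteq> bot"
  shows "0 < Liminf G (\<lambda>x. ennreal (f x / k)) \<and> Limsup G (\<lambda>x. ennreal (f x / k)) < \<infinity>
    \<longleftrightarrow> positively_bounded f G"
proof
  assume *: "0 < Liminf G (\<lambda>x. ennreal (f x / k)) \<and> Limsup G (\<lambda>x. ennreal (f x / k)) < \<infinity>"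
  then obtain y where y: "0 < y" "y < Liminf G (\<lambda>x. ennreal (f x / k))" using dense by blast
  then obtain c where c: "y = ennreal c" "0 < c" by (cases y) (auto simp: top_unique)
  obtain z where z: "Limsup G (\<lambda>x. ennreal (f x / k)) < z" "z < \<infinity>"
    using * dense by blast
  then obtain C where C: "z = ennreal C" "0 \<le> C" by (cases z) auto
  from less_LiminfD[OF y(2)] Limsup_lessD[OF z(1)]
  have "\<forall>\<^sub>F x in G. c * k \<le> f x \<and> f x \<le> C * k"
  proof eventually_elim
    case (elim x)
    then have "c < f x / k" "f x / k < C"
      using c C by (simp_all add: ennreal_less_iff)
    then show ?case using \<open>0 < k\<close> by (simp add: pos_less_divide_eq pos_divide_less_eq)
  qed
  moreover have "0 < c * k" using c \<open>0 < k\<close> by simp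
  ultimately show "positively_bounded f G" unfolding positively_bounded_def by blast
next
  assume "positively_bounded f G"
  then obtain c C where "0 < c" and ev: "\<forall>\<^sub>F x in G. c \<le> f x \<and> f x \<le> C"
    unfolding positively_bounded_def by blast
  have "ennreal (c / k) \<le> Liminf G (\<lambda>x. ennreal (f x / k))"
    using ev \<open>0 < k\<close> by (intro Liminf_bounded)
      (auto elim!: eventually_mono intro!: ennreal_leI divide_right_mono)
  moreover have "Limsup G (\<lambda>x. ennreal (f x / k)) \<le> ennreal (C / k)"
    using ev \<open>0 < k\<close> by (intro Limsup_bounded)
      (auto elim!: eventually_mono intro!: ennreal_leI divide_right_mono)
  moreover have "0 < ennreal (c / k)" using \<open>0 < c\<close> \<open>0 < k\<close> by simp
  moreover have "ennreal (C / k) < \<infinity>" by simp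
  ultimately show "0 < Liminf G (\<lambda>x. ennreal (f x / k)) \<and> Limsup G (\<lambda>x. ennreal (f x / k)) < \<infinity>"
    by (meson le_less_trans less_le_trans)
qed

lemma Liminf_Limsup_ennreal_eq_iff:
  fixes f :: "'a \<Rightarrow> real"
  assumes "0 < k" "G \<noteq> bot" "\<forall>\<^sub>F x in G. 0 \<le> f x" "0 \<le> m"
  shows "Liminf G (\<lambda>x. ennreal (f x / k)) = ennreal m \<and> Limsup G (\<lambda>x. ennreal (f x / k)) = ennreal m
    \<longleftrightarrow> (f \<longlongrightarrow> k * m) G"
proof -
  have "Liminf G (\<lambda>x. ennreal (f x / k)) = ennreal m \<and> Limsup G (\<lambda>x. ennreal (f x / k)) = ennreal m
      \<longleftrightarrow> ((\<lambda>x. ennreal (f x / k)) \<longlongrightarrow> ennreal m) G"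
    using tendsto_iff_Liminf_eq_Limsup[of G "\<lambda>x. ennreal (f x / k)" "ennreal m"] assms(2) by auto
  also have "\<dots> \<longleftrightarrow> ((\<lambda>x. f x / k) \<longlongrightarrow> m) G"
    using assms by (intro tendsto_ennreal_iff) (auto elim: eventually_mono)
  also have "\<dots> \<longleftrightarrow> (f \<longlongrightarrow> k * m) G"
    using tendsto_mult_left[of "\<lambda>x. f x / k" m G k]
      tendsto_divide[of f "k * m" G "\<lambda>_. k" k] \<open>0 < k\<close> by auto
  finally show ?thesis .
qed

section \<open>The contents of a compact set in terms of its fractal string\<close>

context gap_enumeration
begin

definition volume :: "real \<Rightarrow> real" where
  "volume r = measure lborel (parallel_set F r)"

definition boundary :: "real \<Rightarrow> real" where
  "boundary r = 2 + 2 * real (card (long r))"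

lemma minkowski_content_eq:
  assumes "t \<le> 1"
  shows "lower_minkowski_content t F
      = Liminf (at_right 0) (\<lambda>r. ennreal (volume r / r powr (1 - t) / unit_ball_vol (1 - t)))"
    and "upper_minkowski_content t F
      = Limsup (at_right 0) (\<lambda>r. ennreal (volume r / r powr (1 - t) / unit_ball_vol (1 - t)))"
proof -
  have "\<forall>\<^sub>F r in at_right 0. hausdorff_measure 1 (parallel_set F r)
      / ennreal (unit_ball_vol (1 - t) * r powr (1 - t))
    = ennreal (volume r / r powr (1 - t) / unit_ball_vol (1 - t))"
    using eventually_at_right_less[of 0]
  proof eventually_elim
    case (elim r)
    then have "0 < unit_ball_vol (1 - t) * r powr (1 - t)"
      using assms by (intro mult_pos_pos unit_ball_vol_pos) auto
    then show ?case
      unfolding hausdorff_measure_1_parallel_set volume_def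
      by (subst divide_ennreal) (auto simp: mult.commute)
  qed
  then show "lower_minkowski_content t F
      = Liminf (at_right 0) (\<lambda>r. ennreal (volume r / r powr (1 - t) / unit_ball_vol (1 - t)))"
    and "upper_minkowski_content t F
      = Limsup (at_right 0) (\<lambda>r. ennreal (volume r / r powr (1 - t) / unit_ball_vol (1 - t)))"
    unfolding lower_minkowski_content_def upper_minkowski_content_def
    by (rule Liminf_eq, rule Limsup_eq)
qed

lemma S_content_eq:
  assumes "t < 1"
  shows "lower_S_content t F
      = Liminf (at_right 0) (\<lambda>r. ennreal
          (boundary r / r powr - t / ((1 - t) * unit_ball_vol (1 - t))))"
    and "upper_S_content t F
      = Limsup (at_right 0) (\<lambda>r. ennreal
          (boundary r / r powr - t / ((1 - t) * unit_ball_vol (1 - t))))"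
proof -
  have "\<forall>\<^sub>F r in at_right 0. hausdorff_measure 0 (frontier (parallel_set F r))
      / ennreal ((1 - t) * unit_ball_vol (1 - t) * r powr - t)
    = ennreal (boundary r / r powr - t / ((1 - t) * unit_ball_vol (1 - t)))"
    using eventually_at_right_less[of 0]
  proof eventually_elim
    case (elim r)
    then have "0 < (1 - t) * unit_ball_vol (1 - t) * r powr - t"
      using assms by (intro mult_pos_pos unit_ball_vol_pos) auto
    then show ?case
      unfolding hausdorff_measure_0_frontier[OF elim] boundary_def
      by (subst divide_ennreal) (auto simp: mult_ac)
  qed
  then show "lower_S_content t F
      = Liminf (at_right 0) (\<lambda>r. ennreal
          (boundary r / r powr - t / ((1 - t) * unit_ball_vol (1 - t))))"
    and "upper_S_content t F
      = Limsup (at_right 0) (\<lambda>r. ennreal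
          (boundary r / r powr - t / ((1 - t) * unit_ball_vol (1 - t))))"
    unfolding lower_S_content_def upper_S_content_def
    by (rule Liminf_eq, rule Limsup_eq)
qed

text \<open>
  A Minkowski dimension below 1 provides \<open>t < 1\<close> whose upper content vanishes, so the volume is
  \<open>o(r powr (1 - t))\<close>. This is where \<open>F\<close> turns out to have measure zero.
\<close>

lemma volume_tendsto_0:
  assumes "has_minkowski_dim F D" "D < 1"
  shows "(volume \<longlongrightarrow> 0) (at_right 0)"
proof -
  have "(INF t \<in> {t. 0 \<le> t \<and> t \<le> 1 \<and> upper_minkowski_content t F = 0}. ereal t) < 1"
    using assms by (simp add: has_minkowski_dim_def)
  then obtain t where t: "t < 1" "upper_minkowski_content t F = 0"
    unfolding INF_less_iff by auto
  define f where "f = (\<lambda>r. volume r / r powr (1 - t))"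
  have pos: "0 < unit_ball_vol (1 - t)" using t by simp
  have "Limsup (at_right 0) (\<lambda>r. ennreal (f r / unit_ball_vol (1 - t))) = 0"
    using t minkowski_content_eq(2)[of t] by (simp add: f_def)
  moreover from this
  have "Liminf (at_right 0) (\<lambda>r. ennreal (f r / unit_ball_vol (1 - t))) = 0"
    using Liminf_le_Limsup[of "at_right (0::real)" "\<lambda>r. ennreal (f r / unit_ball_vol (1 - t))"]
    by simp
  ultimately have "(f \<longlongrightarrow> unit_ball_vol (1 - t) * 0) (at_right 0)"
    using pos by (intro Liminf_Limsup_ennreal_eq_iff[THEN iffD1]) (auto simp: f_def volume_def)
  moreover have "((\<lambda>r. r powr (1 - t)) \<longlongrightarrow> 0) (at_right (0::real))"
    using t by (intro tendsto_zero_powrI[OF tendsto_ident_at tendsto_const])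
      (auto simp: eventually_at_right_field intro: exI[of _ 1])
  ultimately have "((\<lambda>r. f r * r powr (1 - t)) \<longlongrightarrow> 0) (at_right 0)"
    using tendsto_mult by fastforce
  then show ?thesis
    by (rule Lim_transform_eventually)
      (auto simp: f_def eventually_at_right_field intro: exI[of _ 1])
qed

lemma antitone_density_volume:
  assumes "has_minkowski_dim F D" "D < 1"
  shows "antitone_density volume boundary (1 - D)"
  using measure_parallel_set_increment volume_tendsto_0[OF assms] assms(2)
  by unfold_locales (simp_all add: volume_def boundary_def)

end

text \<open>
  With \<open>v\<close> and \<open>\<sigma>\<close> the normalized volume and boundary count, the contents are lower and upper limits of
  \<open>v / k\<close> and \<open>\<sigma> / ((1 - D) * k)\<close>, where \<open>k = unit_ball_vol (1 - D)\<close>; the factor \<open>1 - D\<close> between the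
  limits of \<open>v\<close> and \<open>\<sigma>\<close> is the reason why both contents agree. Since \<open>\<sigma> r = 2 powr (1 - D) * \<nu> (2 * r)\<close>,
  the content belonging to the lengths \<open>L * j powr (- 1 / D)\<close> has the stated value, called \<open>M L\<close> below.
  As \<open>M\<close> maps the positive numbers onto themselves, every positive finite content comes from some \<open>L\<close>.
\<close>

theorem theorem5p1:
  fixes F :: "real set" and D :: real and l :: "nat \<Rightarrow> real"
  assumes "compact F"
    and "has_minkowski_dim F D"
    and "0 < D" and "D < 1"
    and "fractal_string F l"
  shows
    "(((0 < lower_minkowski_content D F \<and>
       lower_minkowski_content D F \<le> upper_minkowski_content D F \<and>
       upper_minkowski_content D F < \<infinity>)
      \<longleftrightarrow>
      (0 < lower_S_content D F \<and>
       lower_S_content D F \<le> upper_S_content D F \<and>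
       upper_S_content D F < \<infinity>)) \<and>
     ((0 < lower_S_content D F \<and>
       lower_S_content D F \<le> upper_S_content D F \<and>
       upper_S_content D F < \<infinity>)
      \<longleftrightarrow> asymp_comparable l (\<lambda>j. real j powr (- 1 / D)))) \<and>
     ((minkowski_measurable D F \<longleftrightarrow> S_measurable D F) \<and>
     (S_measurable D F \<longleftrightarrow> (\<exists>L>0. l \<sim>[at_top] (\<lambda>j. L * real j powr (- 1 / D))))) \<and>
     (\<forall>L>0. l \<sim>[at_top] (\<lambda>j. L * real j powr (- 1 / D)) \<longrightarrow>
       has_minkowski_content D F
         (ennreal (2 powr (1 - D) / unit_ball_vol (1 - D) * (L powr D / (1 - D)))) \<and>
       has_S_content D F
         (ennreal (2 powr (1 - D) / unit_ball_vol (1 - D) * (L powr D / (1 - D)))))"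
proof -
  obtain a b where "gap_enumeration F a b" and l: "\<And>j. 1 \<le> j \<Longrightarrow> l j = b j - a j"
    using fractal_string_gap_enumeration[OF \<open>compact F\<close> \<open>fractal_string F l\<close>] by blast
  interpret gap_enumeration F a b by fact
  interpret V: antitone_density volume boundary "1 - D"
    using antitone_density_volume assms by blast
  have long: "long r = {j. 1 \<le> j \<and> 2 * r < l j}" for r
    using l by (auto simp: long_def)
  interpret L: length_sequence l D
  proof
    show "0 < l j" if "1 \<le> j" for j using l[OF that] less[OF that] by simp
    show "l j \<le> l i" if "1 \<le> i" "i \<le> j" for i j
      using \<open>fractal_string F l\<close> that by (simp add: fractal_string_def)
    show "finite {j. 1 \<le> j \<and> x < l j}" if "0 < x" for x
      using finite_long[of "x / 2"] that by (simp add: long)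
  qed fact
  define k where "k = unit_ball_vol (1 - D)"
  have k: "0 < k" "0 < (1 - D) * k" using \<open>D < 1\<close> by (simp_all add: k_def)
  have \<sigma>_def: "V.\<sigma> = (\<lambda>r. boundary r / r powr - D)"
    by (simp add: V.\<sigma>_def fun_eq_iff)
  have contents:
    "lower_minkowski_content D F = Liminf (at_right 0) (\<lambda>r. ennreal (V.v r / k))"
    "upper_minkowski_content D F = Limsup (at_right 0) (\<lambda>r. ennreal (V.v r / k))"
    "lower_S_content D F = Liminf (at_right 0) (\<lambda>r. ennreal (V.\<sigma> r / ((1 - D) * k)))"
    "upper_S_content D F = Limsup (at_right 0) (\<lambda>r. ennreal (V.\<sigma> r / ((1 - D) * k)))"
    using minkowski_content_eq[of D] S_content_eq[of D] \<open>D < 1\<close>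
    by (simp_all add: V.v_def[abs_def] \<sigma>_def k_def)
  have \<sigma>_\<nu>: "\<forall>\<^sub>F r in at_right 0. V.\<sigma> r = 2 powr (1 - D) * L.\<nu> (2 * r)"
    using eventually_at_right_less[of 0]
  proof eventually_elim
    case (elim r)
    have "boundary r = 2 * (1 + real (L.N (2 * r)))"
      by (simp add: boundary_def long L.N_def)
    then show ?case
      using elim by (simp add: \<sigma>_def L.\<nu>_def powr_minus_divide powr_mult powr_diff)
  qed
  have double: "filtermap ((*) 2) (at_right 0) = at_right (0::real)"
    using filtermap_times_pos_at_right[of 2 0] by simp

  have bounds_M: "0 < lower_minkowski_content D F \<and>
       lower_minkowski_content D F \<le> upper_minkowski_content D F \<and>
       upper_minkowski_content D F < \<infinity> \<longleftrightarrow> positively_bounded V.v (at_right 0)"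
    using Liminf_Limsup_ennreal_bounds[OF k(1), of "at_right 0" V.v]
      Liminf_le_Limsup[of "at_right (0::real)"] unfolding contents by auto
  have bounds_S: "0 < lower_S_content D F \<and>
       lower_S_content D F \<le> upper_S_content D F \<and>
       upper_S_content D F < \<infinity> \<longleftrightarrow> positively_bounded V.\<sigma> (at_right 0)"
    using Liminf_Limsup_ennreal_bounds[OF k(2), of "at_right 0" V.\<sigma>]
      Liminf_le_Limsup[of "at_right (0::real)"] unfolding contents by auto
  have "positively_bounded V.\<sigma> (at_right 0)
      \<longleftrightarrow> positively_bounded (\<lambda>r. 2 powr (1 - D) * L.\<nu> (2 * r)) (at_right 0)"
    by (rule positively_bounded_cong[OF \<sigma>_\<nu>])
  also have "\<dots> \<longleftrightarrow> positively_bounded (\<lambda>r. L.\<nu> (2 * r)) (at_right 0)"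
    by (rule positively_bounded_scale_iff) simp
  also have "\<dots> \<longleftrightarrow> positively_bounded L.\<nu> (at_right 0)"
    using positively_bounded_filtermap[of L.\<nu> "(*) 2" "at_right 0"] by (simp add: double)
  also have "\<dots> \<longleftrightarrow> asymp_comparable l (\<lambda>j. real j powr (- 1 / D))"
    by (simp only: L.positively_bounded_iff L.asymp_comparable_iff)
  finally have part_a: "positively_bounded V.\<sigma> (at_right 0)
      \<longleftrightarrow> asymp_comparable l (\<lambda>j. real j powr (- 1 / D))" .

  have nonneg: "\<forall>\<^sub>F r in at_right 0. 0 \<le> V.v r" "\<forall>\<^sub>F r in at_right 0. 0 \<le> V.\<sigma> r"
    by (auto simp: V.v_def \<sigma>_def volume_def boundary_def)
  have has_S: "has_S_content D F (ennreal m) \<longleftrightarrow> (V.\<sigma> \<longlongrightarrow> (1 - D) * k * m) (at_right 0)"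
    if "0 \<le> m" for m
    unfolding has_S_content_def contents
    by (rule Liminf_Limsup_ennreal_eq_iff) (use k nonneg that in auto)
  have has_M_S: "has_minkowski_content D F (ennreal m) \<longleftrightarrow> has_S_content D F (ennreal m)"
    if "0 \<le> m" for m
  proof -
    have "has_minkowski_content D F (ennreal m) \<longleftrightarrow> (V.v \<longlongrightarrow> k * m) (at_right 0)"
      unfolding has_minkowski_content_def contents
      by (rule Liminf_Limsup_ennreal_eq_iff) (use k nonneg that in auto)
    then show ?thesis
      using has_S[OF that] V.tendsto_iff[of "k * m"] by (simp add: mult.assoc)
  qed
  define M where "M = (\<lambda>L. 2 powr (1 - D) / k * (L powr D / (1 - D)))"
  have M_pos: "0 < M L" if "0 < L" for L
    using that k(1) \<open>D < 1\<close> by (simp add: M_def)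
  have string: "has_S_content D F (ennreal (M L))
      \<longleftrightarrow> l \<sim>[at_top] (\<lambda>j. L * real j powr (- 1 / D))" if "0 < L" for L
  proof -
    have "has_S_content D F (ennreal (M L)) \<longleftrightarrow> (V.\<sigma> \<longlongrightarrow> (1 - D) * k * M L) (at_right 0)"
      using has_S M_pos[OF that] by simp
    also have "(1 - D) * k * M L = 2 powr (1 - D) * L powr D"
      using k(1) \<open>D < 1\<close> by (simp add: M_def)
    also have "(V.\<sigma> \<longlongrightarrow> 2 powr (1 - D) * L powr D) (at_right 0)
        \<longleftrightarrow> ((\<lambda>r. 2 powr (1 - D) * L.\<nu> (2 * r)) \<longlongrightarrow> 2 powr (1 - D) * L powr D) (at_right 0)"
      by (rule tendsto_cong[OF \<sigma>_\<nu>])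
    also have "\<dots> \<longleftrightarrow> ((\<lambda>r. L.\<nu> (2 * r)) \<longlongrightarrow> L powr D) (at_right 0)"
      by (rule tendsto_mult_left_iff) simp
    also have "\<dots> \<longleftrightarrow> (L.\<nu> \<longlongrightarrow> L powr D) (at_right 0)"
      using filterlim_filtermap[of L.\<nu> "nhds (L powr D)" "(*) 2" "at_right 0"]
      by (simp add: double)
    also have "\<dots> \<longleftrightarrow> l \<sim>[at_top] (\<lambda>j. L * real j powr (- 1 / D))"
      by (simp only: L.tendsto_iff L.asymp_equiv_iff[OF that])
    finally show ?thesis .
  qed
  have M_surj: "\<exists>L>0. M L = m" if "0 < m" for m
  proof -
    define q where "q = m * k * (1 - D) / 2 powr (1 - D)"
    have "0 < q" using that k(1) \<open>D < 1\<close> by (simp add: q_def)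
    then have "(q powr (1 / D)) powr D = q" using \<open>0 < D\<close> by (simp add: powr_powr)
    then have "M (q powr (1 / D)) = m"
      unfolding M_def using k(1) \<open>D < 1\<close> by (simp add: q_def)
    then show ?thesis using \<open>0 < q\<close> by (intro exI[of _ "q powr (1 / D)"]) simp
  qed
  have finite_content: "(\<exists>c. P c \<and> 0 < c \<and> c < \<infinity>) \<longleftrightarrow> (\<exists>m>0. P (ennreal m))" for P
  proof
    assume "\<exists>c. P c \<and> 0 < c \<and> c < \<infinity>"
    then obtain c where "P c" "0 < c" "c < \<infinity>" by blast
    then show "\<exists>m>0. P (ennreal m)" by (cases c) auto
  next
    assume "\<exists>m>0. P (ennreal m)"
    then obtain m where "0 < m" "P (ennreal m)" by blast
    then show "\<exists>c. P c \<and> 0 < c \<and> c < \<infinity>" by (intro exI[of _ "ennreal m"]) auto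
  qed
  have measurable_iff: "minkowski_measurable D F \<longleftrightarrow> S_measurable D F"
    unfolding minkowski_measurable_def S_measurable_def finite_content
    using has_M_S by (meson less_imp_le)
  have S_iff: "S_measurable D F \<longleftrightarrow> (\<exists>L>0. l \<sim>[at_top] (\<lambda>j. L * real j powr (- 1 / D)))"
    unfolding S_measurable_def finite_content using string M_surj M_pos by metis
  have content_values: "\<forall>L>0. l \<sim>[at_top] (\<lambda>j. L * real j powr (- 1 / D)) \<longrightarrow>
       has_minkowski_content D F (ennreal (M L)) \<and> has_S_content D F (ennreal (M L))"
    using string has_M_S M_pos by (meson less_imp_le)
  show ?thesis
    using bounds_M bounds_S V.positively_bounded_iff part_a measurable_iff S_iff content_values
    unfolding M_def k_def by blast
qed

end
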